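(* Let $1<p<\infty$, $w\in A_p(\mathbb{R})$, $f\in L^p(\mathbb{R},w)$, and $0<\alpha<\pi/2$. If $u$ is harmonic in $\mathbb{R}^2_+$ with $\partial_yu=f$ on $\mathbb{R}$ in the sense of non-tangential convergence and $N^+_\alpha\nabla u\in L^p(\mathbb{R},w)$, then there exists a constant $C$ such that $u=u_f+C$ in $\mathbb{R}^2_+$, where $$u_f(x,y)=\frac1\pi\int_{\mathbb{R}}\log\Big(\frac{\sqrt{(x-t)^2+y^2}}{1+|t|}\Big)f(t)\,dt,\qquad (x,y)\in\mathbb{R}^2_+.$$
   Context: $A_p(\mathbb{R})$ is the Muckenhoupt class: weights $w$ with $\sup_I\big(\frac1{|I|}\int_Iw\big)\big(\frac1{|I|}\int_Iw^{1-p'}\big)^{p-1}<\infty$ over intervals $I$. $L^p(\mathbb{R},w)$ has norm $(\int|f|^pw)^{1/p}$. $\Gamma^+_\alpha(x)=\{z:\operatorname{Im}z>0,\ |\operatorname{Re}z-x|<\tan(\alpha)\operatorname{Im}z\}$ and $N^+_\alpha F(x)=\sup_{z\in\Gamma^+_\alpha(x)}|F(z)|$; non-tangential convergence at $x$ means convergence as $z\to x$ within $\Gamma^+_\alpha(x)$ (for a.e. $x$). *)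

theory Defs
  imports "HOL-Analysis.Analysis"
begin

text \<open>Points of the plane are complex numbers z = x + i y; the upper half-plane is Im z > 0.\<close>

definition upper_half_plane :: "complex set" where
  "upper_half_plane = {z. 0 < Im z}"

definition px :: "(complex \<Rightarrow> real) \<Rightarrow> complex \<Rightarrow> real" where
  "px u z = frechet_derivative u (at z) 1"

definition py :: "(complex \<Rightarrow> real) \<Rightarrow> complex \<Rightarrow> real" where
  "py u z = frechet_derivative u (at z) \<i>"

definition grad :: "(complex \<Rightarrow> real) \<Rightarrow> complex \<Rightarrow> complex" where
  "grad u z = Complex (px u z) (py u z)"

definition harmonic_on :: "complex set \<Rightarrow> (complex \<Rightarrow> real) \<Rightarrow> bool" where
  "harmonic_on S u \<longleftrightarrow> open S \<and>
     (\<forall>z\<in>S. u differentiable (at z) \<and> px u differentiable (at z) \<and> py u differentiable (at z)) \<and>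
     continuous_on S (px (px u)) \<and> continuous_on S (py (py u)) \<and>
     continuous_on S (px (py u)) \<and> continuous_on S (py (px u)) \<and>
     (\<forall>z\<in>S. px (px u) z + py (py u) z = 0)"

text \<open>Muckenhoupt A_p class on the real line (1 < p < infinity), p' = p/(p-1).\<close>
definition Ap_weight :: "real \<Rightarrow> (real \<Rightarrow> real) \<Rightarrow> bool" where
  "Ap_weight p w \<longleftrightarrow>
     w \<in> borel_measurable lborel \<and> (\<forall>x. 0 \<le> w x) \<and> (AE x in lborel. 0 < w x) \<and>
     (\<exists>K. \<forall>a b. a < b \<longrightarrow>
        set_integrable lborel {a..b} w \<and>
        set_integrable lborel {a..b} (\<lambda>x. w x powr (1 - p / (p - 1))) \<and>
        ((1 / (b - a)) * (LINT x:{a..b}|lborel. w x)) *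
        ((1 / (b - a)) * (LINT x:{a..b}|lborel. w x powr (1 - p / (p - 1)))) powr (p - 1) \<le> K)"

definition in_Lpw :: "real \<Rightarrow> (real \<Rightarrow> real) \<Rightarrow> (real \<Rightarrow> real) \<Rightarrow> bool" where
  "in_Lpw p w f \<longleftrightarrow> f \<in> borel_measurable lborel \<and> integrable lborel (\<lambda>x. \<bar>f x\<bar> powr p * w x)"

definition in_Lpw_enn :: "real \<Rightarrow> (real \<Rightarrow> real) \<Rightarrow> (real \<Rightarrow> ennreal) \<Rightarrow> bool" where
  "in_Lpw_enn p w N \<longleftrightarrow> (AE x in lborel. N x < \<infinity>) \<and> in_Lpw p w (\<lambda>x. enn2real (N x))"

definition cone :: "real \<Rightarrow> real \<Rightarrow> complex set" where
  "cone \<alpha> x = {z. 0 < Im z \<and> \<bar>Re z - x\<bar> < tan \<alpha> * Im z}"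

definition ntmax :: "real \<Rightarrow> (complex \<Rightarrow> 'a::real_normed_vector) \<Rightarrow> real \<Rightarrow> ennreal" where
  "ntmax \<alpha> F x = (SUP z\<in>cone \<alpha> x. ennreal (norm (F z)))"

definition u_f :: "(real \<Rightarrow> real) \<Rightarrow> complex \<Rightarrow> real" where
  "u_f f z = (1 / pi) * (LINT t|lborel. ln (sqrt ((Re z - t)\<^sup>2 + (Im z)\<^sup>2) / (1 + \<bar>t\<bar>)) * f t)"

end

theory Submission
  imports Defs "HOL-Complex_Analysis.Complex_Analysis"
begin

text \<open>
  The function \<open>F = u\<^sub>x - i u\<^sub>y\<close> is holomorphic in the upper half-plane, and \<open>\<bar>F(z)\<bar>\<^sup>p w(I) \<le> \<parallel>N \<nabla>u\<parallel>\<^sup>p\<close>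
  for every interval \<open>I\<close> lying in the shadow of \<open>z\<close>. The \<open>A\<^sub>p\<close> condition makes \<open>w([-R,R])\<close> grow
  geometrically along dyadic \<open>R\<close>; hence \<open>F\<close> tends to 0 vertically, \<open>F(z + i\<epsilon>) = o(\<bar>z\<bar>)\<close>, and
  \<open>L\<^sup>p(w)\<close> embeds into \<open>L\<^sup>1(dt / (1 + \<bar>t\<bar>))\<close>. Cauchy's formula for \<open>F(z + i\<epsilon>)\<close> on large rectangles,
  combined with reflection and dominated convergence as \<open>\<epsilon> \<rightarrow> 0\<close>, shows that \<open>F\<close> and the Cauchy transform
  \<open>G(z) = (1/\<pi>) \<integral> f(t) / (z - t) dt\<close> differ by a constant, which is 0 because both decay vertically.
  Since \<open>G\<close> encodes the gradient of \<open>u\<^sub>f\<close>, the difference \<open>u - u\<^sub>f\<close> is constant.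
\<close>

section \<open>Muckenhoupt weights\<close>

text \<open>Only \<open>u_y\<close> has prescribed boundary values; nothing is assumed about a trace
  of \<open>u_x\<close>. A Cauchy formula for \<open>F\<close> alone is therefore not enough: it has
  to be reduced to one in which only \<open>Im F = - u_y\<close> appears, and this is the purpose of
  the reflection. \<open>F\<close> need not extend to the real line either, so the formula is
  applied to vertical translates, which are holomorphic across the line and share the maximal
  function as a majorant there, whatever the size of \<epsilon>. Growth o(R) is too weak for a
  single Cauchy kernel, of size 1/R on a contour of length comparable to R. Differences of kernels
  repair this at the price of an unknown additive constant, so decay along one path is a separate
  ingredient. That decay rests on the total mass of \<open>w\<close> being infinite. For a weight of
  finite mass, \<open>u = x\<close> would have data 0 and an admissible maximal function without
  being constant; the A_p condition excludes this.\<close>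

lemma set_integral_mono_interval:
  fixes g :: "real \<Rightarrow> real"
  assumes "set_integrable lborel {a..b} g" "\<And>x. 0 \<le> g x" "a \<le> c" "d \<le> b"
  shows "(LINT x:{c..d}|lborel. g x) \<le> (LINT x:{a..b}|lborel. g x)"
proof -
  have "set_integrable lborel {c..d} g"
    using assms by (intro set_integrable_subset[OF assms(1)]) auto
  with assms show ?thesis
    unfolding set_lebesgue_integral_def set_integrable_def
    by (intro integral_mono) (auto simp: indicator_def)
qed

text \<open>Fixing a bound \<open>K\<close> for the A_p products turns it into a parameter, from
  which the growth and decay rates \<delta> and \<rho> below are built.\<close>

locale muckenhoupt =
  fixes p K :: real and w :: "real \<Rightarrow> real"
  assumes p_gt_1: "1 < p"
    and w_meas [measurable]: "w \<in> borel_measurable borel"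
    and w_nonneg: "0 \<le> w x"
    and w_pos: "AE x in lborel. 0 < w x"
    and w_int: "a < b \<Longrightarrow> set_integrable lborel {a..b} w"
    and \<sigma>_int: "a < b \<Longrightarrow> set_integrable lborel {a..b} (\<lambda>x. w x powr (1 - p / (p - 1)))"
    and Ap_bound: "a < b \<Longrightarrow>
        ((1 / (b - a)) * (LINT x:{a..b}|lborel. w x)) *
        ((1 / (b - a)) * (LINT x:{a..b}|lborel. w x powr (1 - p / (p - 1)))) powr (p - 1) \<le> K"
begin

text \<open>The dual weight: 1 - p' equals -1/(p - 1), so
  \<open>w x * \<sigma> x powr (p - 1) = 1\<close> wherever \<open>w\<close> is positive. On the
  null set of zeros of \<open>w\<close>, the convention for \<open>powr\<close> gives \<sigma> the
  value 0.\<close>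

definition \<sigma> :: "real \<Rightarrow> real" where "\<sigma> x = w x powr (1 - p / (p - 1))"
definition W :: "real \<Rightarrow> real \<Rightarrow> real" where "W a b = (LINT x:{a..b}|lborel. w x)"
definition S :: "real \<Rightarrow> real \<Rightarrow> real" where "S a b = (LINT x:{a..b}|lborel. \<sigma> x)"

lemma \<sigma>_meas [measurable]: "\<sigma> \<in> borel_measurable borel"
  unfolding \<sigma>_def[abs_def] by measurable

lemma \<sigma>_nonneg: "0 \<le> \<sigma> x"
  by (simp add: \<sigma>_def)

lemma \<sigma>_integrable: "a < b \<Longrightarrow> set_integrable lborel {a..b} \<sigma>"
  using \<sigma>_int by (simp add: \<sigma>_def[abs_def])

lemma \<sigma>_exponent: "1 - p / (p - 1) = - (1 / (p - 1))"
  using p_gt_1 by (simp add: field_simps)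

lemma S_nonneg: "0 \<le> S a b"
  unfolding S_def set_lebesgue_integral_def by (intro Bochner_Integration.integral_nonneg) (simp add: \<sigma>_nonneg)

lemma W_pos:
  assumes "a < b" shows "0 < W a b"
proof -
  have nn: "0 \<le> W a b"
    unfolding W_def set_lebesgue_integral_def by (intro Bochner_Integration.integral_nonneg) (simp add: w_nonneg)
  have "W a b \<noteq> 0"
  proof
    assume "W a b = 0"
    then have "AE x in lborel. indicator {a..b} x *\<^sub>R w x = 0"
      unfolding W_def set_lebesgue_integral_def
      using w_int[OF assms, unfolded set_integrable_def]
      by (subst (asm) integral_nonneg_eq_0_iff_AE) (auto simp: w_nonneg)
    with w_pos have "AE x in lborel. x \<notin> {a..b}"
      by eventually_elim (auto simp: indicator_def)
    then have "emeasure lborel {a..b} = 0"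
      by (subst (asm) AE_iff_measurable[where N="{a..b}"]) auto
    with assms show False by simp
  qed
  with nn show ?thesis by simp
qed

lemma W_mono:
  assumes "c < d" "a \<le> c" "d \<le> b" shows "W c d \<le> W a b"
  unfolding W_def using assms
  by (intro set_integral_mono_interval w_int w_nonneg) auto

lemma S_mono:
  assumes "c < d" "a \<le> c" "d \<le> b" shows "S c d \<le> S a b"
  unfolding S_def using assms
  by (intro set_integral_mono_interval \<sigma>_integrable \<sigma>_nonneg) auto

lemma W_add3:
  assumes "a < c" "c < d" "d < b" shows "W a b = W a c + W c d + W d b"
proof -
  have *: "W a b = W a c + W c b" if "a < c" "c < b" for a b c
  proof -
    have "W a b = (LINT x:{a..c} \<union> {c..b}|lborel. w x)"
      using that by (simp add: W_def ivl_disj_un_two_touch)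
    also have "\<dots> = W a c + W c b"
      unfolding W_def
    proof (rule set_integral_Un_AE)
      show "AE x in lborel. \<not> (x \<in> {a..c} \<and> x \<in> {c..b})"
        using AE_lborel_singleton[of c] by eventually_elim auto
    qed (use that w_int in auto)
    finally show ?thesis .
  qed
  show ?thesis using *[of a c b] *[of c d b] assms by simp
qed

section \<open>Masses of a weight and of its dual on an interval\<close>

lemma W_S_upper:
  assumes "a < b" shows "W a b * S a b powr (p - 1) \<le> K * (b - a) powr p"
proof -
  \<comment> \<open>Because p = 1 + (p - 1), the power of the length splits into one factor for each
    of the two averages.\<close>
  have "W a b * S a b powr (p - 1) / (b - a) powr p =
     ((1 / (b - a)) * W a b) * ((1 / (b - a)) * S a b) powr (p - 1)"
    using assms S_nonneg[of a b] powr_add[of "b - a" 1 "p - 1"]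
    by (simp add: powr_divide)
  also have "\<dots> \<le> K" using Ap_bound[OF assms] by (simp add: W_def S_def \<sigma>_def)
  finally show ?thesis using assms by (simp add: divide_simps)
qed

text \<open>The quantities \<open>L * w x\<close> and
  \<open>(L * w x) powr (- (1 / (p - 1)))\<close> have weighted geometric mean 1 for the weights 1/p
  and (p - 1)/p, so their arithmetic mean is at least 1. The scale \<open>L\<close> stays free until
  after integration.\<close>

lemma young_weight:
  assumes "0 < w x" "0 < L"
  shows "1 \<le> 1 / p * (L * w x) + (p - 1) / p * (L powr (- (1 / (p - 1))) * \<sigma> x)"
proof -
  have "(L * w x) powr (1 / p) * ((L * w x) powr (- (1 / (p - 1)))) powr ((p - 1) / p)
      \<le> 1 / p * (L * w x) + (p - 1) / p * (L * w x) powr (- (1 / (p - 1)))"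
    using p_gt_1 assms by (intro Youngs_inequality_0) (auto simp: field_simps)
  also have "(L * w x) powr (1 / p) * ((L * w x) powr (- (1 / (p - 1)))) powr ((p - 1) / p) = 1"
    using p_gt_1 assms by (simp add: powr_powr flip: powr_add)
  also have "(L * w x) powr (- (1 / (p - 1))) = L powr (- (1 / (p - 1))) * \<sigma> x"
    using assms by (simp add: powr_mult \<sigma>_def \<sigma>_exponent)
  finally show ?thesis .
qed

text \<open>Young's inequality with \<open>L\<close> chosen to balance both terms replaces Hoelder's inequality here.\<close>

lemma W_S_lower:
  assumes "a < b" shows "(b - a) powr p \<le> W a b * S a b powr (p - 1)"
proof -
  define L where "L = (b - a) / W a b"
  define r where "r = 1 / (p - 1)"
  have L: "0 < L" using assms W_pos[OF assms] by (simp add: L_def)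
  have iw: "set_integrable lborel {a..b} (\<lambda>x. 1 / p * (L * w x))"
    and iS: "set_integrable lborel {a..b} (\<lambda>x. (p - 1) / p * (L powr (- r) * \<sigma> x))"
    using w_int[OF assms] \<sigma>_integrable[OF assms] by (intro set_integrable_mult_right; simp)+
  have "b - a = (LINT x:{a..b}|lborel. 1)"
    using assms by (simp add: set_integral_const)
  also have "\<dots> \<le> (LINT x:{a..b}|lborel. 1 / p * (L * w x) + (p - 1) / p * (L powr (- r) * \<sigma> x))"
  proof (rule set_integral_mono_AE)
    show "AE x\<in>{a..b} in lborel. 1 \<le> 1 / p * (L * w x) + (p - 1) / p * (L powr (- r) * \<sigma> x)"
      using w_pos by eventually_elim (use L young_weight r_def in auto)
    show "set_integrable lborel {a..b} (\<lambda>x. 1 / p * (L * w x) + (p - 1) / p * (L powr (- r) * \<sigma> x))"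
      by (intro set_integral_add iw iS)
  qed (auto intro!: borel_integrable_atLeastAtMost')
  also have "\<dots> = 1 / p * (L * W a b) + (p - 1) / p * (L powr (- r) * S a b)"
    by (subst set_integral_add[OF iw iS]) (simp add: W_def S_def)
  also have "L * W a b = b - a" using W_pos[OF assms] by (simp add: L_def)
  finally have "(p - 1) / p * (b - a) \<le> (p - 1) / p * (L powr (- r) * S a b)"
    using p_gt_1 by (simp add: field_simps)
  then have "b - a \<le> L powr (- r) * S a b"
    by (rule mult_left_le_imp_le) (use p_gt_1 in auto)
  then have "(b - a) powr (p - 1) \<le> (L powr (- r) * S a b) powr (p - 1)"
    using assms p_gt_1 by (intro powr_mono2) auto
  also have "\<dots> = S a b powr (p - 1) / L"
    using S_nonneg[of a b] p_gt_1 L by (subst powr_mult, subst powr_powr) (simp add: r_def powr_minus_divide)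
  finally have "(b - a) powr (p - 1) * (b - a) \<le> W a b * S a b powr (p - 1)"
    using assms W_pos[OF assms] by (simp add: L_def field_simps)
  then show ?thesis using assms powr_add[of "b - a" "p - 1" 1] by simp
qed

lemma K_pos: "0 < K"
proof -
  have "1 \<le> K" using W_S_lower[of 0 1] W_S_upper[of 0 1] by simp
  then show ?thesis by simp
qed

text \<open>The Hoelder-type lower bound on the small interval, monotonicity of the dual mass, and
  the A_p upper bound on the large interval are chained; the dual mass disappears. Thus a
  subinterval keeps at least the share of mass given by the p-th power of its relative length,
  divided by \<open>K\<close>.\<close>

lemma W_compare:
  assumes "c < d" "a \<le> c" "d \<le> b"
  shows "(d - c) powr p * W a b \<le> K * (b - a) powr p * W c d"
proof -
  have "(d - c) powr p * W a b \<le> (W c d * S c d powr (p - 1)) * W a b"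
    using W_S_lower[OF assms(1)] W_pos[of a b] assms by (intro mult_right_mono) auto
  also have "\<dots> \<le> (W c d * S a b powr (p - 1)) * W a b"
    using W_pos[of a b] W_pos[of c d] assms S_mono[OF assms] S_nonneg p_gt_1
    by (intro mult_right_mono mult_left_mono powr_mono2) auto
  also have "\<dots> = W c d * (W a b * S a b powr (p - 1))" by simp
  also have "\<dots> \<le> W c d * (K * (b - a) powr p)"
    using W_pos[of c d] assms by (intro mult_left_mono W_S_upper) auto
  finally show ?thesis by (simp add: ac_simps)
qed

text \<open>\<open>[r, 2r]\<close> is a quarter of \<open>[-2r, 2r]\<close>, so by \<open>W_compare\<close> it carries at
  least the fraction \<open>\<delta>\<close> of its weight.\<close>

definition \<delta> :: real where "\<delta> = 1 / (K * 4 powr p)"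

lemma \<delta>_pos: "0 < \<delta>"
  using K_pos by (simp add: \<delta>_def)

text \<open>Passing from \<open>[-r, r]\<close> to \<open>[-2r, 2r]\<close> adds the mass of
  \<open>[r, 2r]\<close>, which is at least \<delta> times the mass of the doubled interval and
  hence at least \<delta> times the old mass. The mass on the left side is just dropped.\<close>

lemma W_reverse_doubling:
  assumes "0 < r" shows "(1 + \<delta>) * W (-r) r \<le> W (- (2 * r)) (2 * r)"
proof -
  have "r powr p * W (- (2 * r)) (2 * r) \<le> K * (4 * r) powr p * W r (2 * r)"
    using W_compare[of r "2 * r" "- (2 * r)" "2 * r"] assms by simp
  also have "\<dots> = r powr p * (W r (2 * r) / \<delta>)"
    using assms by (simp add: powr_mult \<delta>_def)
  finally have "W (- (2 * r)) (2 * r) \<le> W r (2 * r) / \<delta>"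
    by (rule mult_left_le_imp_le) (use assms in simp)
  then have "\<delta> * W (- (2 * r)) (2 * r) \<le> W r (2 * r)"
    using \<delta>_pos by (simp add: field_simps)
  moreover have "\<delta> * W (-r) r \<le> \<delta> * W (- (2 * r)) (2 * r)"
    using \<delta>_pos assms by (intro mult_left_mono W_mono) auto
  moreover have "W (- (2 * r)) (2 * r) = W (- (2 * r)) (- r) + W (-r) r + W r (2 * r)"
    using assms by (intro W_add3) auto
  moreover have "0 < W (- (2 * r)) (- r)" using assms by (intro W_pos) auto
  ultimately show ?thesis by (simp add: algebra_simps)
qed

lemma W_dyadic_growth: "(1 + \<delta>) ^ k * W (-1) 1 \<le> W (- (2 ^ k)) (2 ^ k)"
proof (induction k)
  case (Suc k)
  have "(1 + \<delta>) ^ Suc k * W (-1) 1 \<le> (1 + \<delta>) * W (- (2 ^ k)) (2 ^ k)"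
    using Suc \<delta>_pos by (simp add: mult.assoc)
  also have "\<dots> \<le> W (- (2 ^ Suc k)) (2 ^ Suc k)"
    using W_reverse_doubling[of "2 ^ k"] by simp
  finally show ?case .
qed simp

lemma W_at_top: "filterlim (\<lambda>r. W (-r) r) at_top at_top"
proof (rule filterlim_at_top[THEN iffD2], rule)
  fix Z :: real
  have W1: "0 < W (-1) 1" by (rule W_pos) simp
  obtain k where k: "Z / W (-1) 1 < (1 + \<delta>) ^ k"
    using real_arch_pow[of "1 + \<delta>"] \<delta>_pos by auto
  have "Z \<le> W (-r) r" if "2 ^ k \<le> r" for r
  proof -
    have "Z \<le> (1 + \<delta>) ^ k * W (-1) 1" using k W1 by (simp add: field_simps)
    also have "\<dots> \<le> W (- (2 ^ k)) (2 ^ k)" by (rule W_dyadic_growth)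
    also have "\<dots> \<le> W (-r) r" using that
      by (intro W_mono) (auto intro: less_trans[of _ 0])
    finally show ?thesis .
  qed
  then show "\<forall>\<^sub>F r in at_top. Z \<le> W (-r) r"
    using eventually_at_top_linorder by blast
qed

section \<open>Decay of the dual weight and the weighted integrability it gives\<close>

definition \<rho> :: real where "\<rho> = (1 + \<delta>) powr (- (1 / (p - 1)))"

lemma \<rho>_bounds: "0 < \<rho>" "\<rho> < 1"
  unfolding \<rho>_def using \<delta>_pos p_gt_1 by (auto simp: powr_less_one)

text \<open>The A_p inequality is solved for the dual mass and the geometric growth of
  \<open>W\<close> is inserted. Scaling alone would give the power p' = p/(p - 1) of the length,
  which is borderline for the tail integral; the extra factor \<open>\<rho> ^ k\<close> makes it
  converge.\<close>

lemma S_dyadic_bound: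
  obtains A where "0 \<le> A"
    "\<And>k. S (- (2 ^ k)) (2 ^ k) \<le> A * (2 ^ k) powr (p / (p - 1)) * \<rho> ^ k"
proof
  define r where "r = 1 / (p - 1)"
  define A where "A = (K * 2 powr p / W (-1) 1) powr r"
  show "0 \<le> A" by (simp add: A_def)
  fix k :: nat
  have W1: "0 < W (-1) 1" by (rule W_pos) simp
  let ?S = "S (- (2 ^ k)) (2 ^ k)" and ?W = "W (- (2 ^ k)) (2 ^ k)"
  have pos: "(0::real) < 2 ^ k" "- (2 ^ k) < (2 ^ k :: real)" by (auto intro: less_trans[of _ 0])
  have "(1 + \<delta>) ^ k * W (-1) 1 * ?S powr (p - 1) \<le> ?W * ?S powr (p - 1)"
    by (intro mult_right_mono W_dyadic_growth) simp
  also have "\<dots> \<le> K * (2 * 2 ^ k) powr p"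
    using W_S_upper[OF pos(2)] by simp
  finally have "?S powr (p - 1) \<le> (K * 2 powr p / W (-1) 1) * (2 ^ k) powr p * (1 / (1 + \<delta>) ^ k)"
    using W1 \<delta>_pos by (simp add: field_simps powr_mult)
  then have "(?S powr (p - 1)) powr r \<le> ((K * 2 powr p / W (-1) 1) * (2 ^ k) powr p * (1 / (1 + \<delta>) ^ k)) powr r"
    using p_gt_1 by (intro powr_mono2) (auto simp: r_def)
  also have "\<dots> = A * ((2 ^ k) powr p) powr r * (1 / (1 + \<delta>) ^ k) powr r"
    unfolding A_def using W1 \<delta>_pos K_pos
    by (simp only: powr_mult[of "_ * _" "1 / (1 + \<delta>) ^ k"] powr_mult[of _ "(2 ^ k) powr p"])
  also have "(1 / (1 + \<delta>) ^ k) powr r = \<rho> ^ k"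
    using \<delta>_pos by (simp add: \<rho>_def r_def powr_divide powr_minus_divide powr_powr power_divide
          flip: powr_realpow)
  also have "((2 ^ k) powr p) powr r = (2 ^ k) powr (p / (p - 1))"
    by (simp add: powr_powr r_def)
  also have "(?S powr (p - 1)) powr r = ?S"
    using S_nonneg p_gt_1 by (simp add: powr_powr r_def)
  finally show "?S \<le> A * (2 ^ k) powr (p / (p - 1)) * \<rho> ^ k" .
qed

lemma integrable_\<sigma>_tail: "integrable lborel (\<lambda>t. \<sigma> t * (1 + \<bar>t\<bar>) powr (- (p / (p - 1))))"
proof -
  define q where "q = p / (p - 1)"
  have q: "0 < q" using p_gt_1 by (simp add: q_def)
  obtain A where A: "0 \<le> A" "\<And>k. S (- (2 ^ k)) (2 ^ k) \<le> A * (2 ^ k) powr q * \<rho> ^ k"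
    using S_dyadic_bound unfolding q_def by blast
  \<comment> \<open>The factor \<open>2 powr q\<close> pays for replacing 1 + |t| by the dyadic
    size, which exceeds it by a factor of at most 2.\<close>
  define c where "c k = 2 powr q * (2 ^ k) powr (- q)" for k :: nat
  define J where "J k = {- (2 ^ k) .. (2 ^ k :: real)}" for k :: nat
  have c0: "0 \<le> c k" for k by (simp add: c_def)
  have dyadic: "\<exists>k. (1 + \<bar>t\<bar>) powr (- q) \<le> c k * indicator (J k) t" for t
  proof -
    obtain n0 where n0: "\<bar>t\<bar> < 2 ^ n0" using real_arch_pow[of 2 "\<bar>t\<bar>"] by auto
    \<comment> \<open>Minimality gives the bound from above: either \<open>k = 0\<close>, or |t|
      exceeds half of \<open>2 ^ k\<close>.\<close>
    define k where "k = (LEAST k. \<bar>t\<bar> \<le> 2 ^ k)"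
    have k: "\<bar>t\<bar> \<le> 2 ^ k" unfolding k_def by (rule LeastI[of _ n0]) (use n0 in simp)
    have "2 ^ k \<le> 2 * (1 + \<bar>t\<bar>)"
    proof (cases k)
      case (Suc m)
      then have "\<not> \<bar>t\<bar> \<le> 2 ^ m" using not_less_Least[of m "\<lambda>k. \<bar>t\<bar> \<le> 2 ^ k"] by (simp add: k_def)
      then show ?thesis using Suc by simp
    qed simp
    then have "(2 * (1 + \<bar>t\<bar>)) powr (- q) \<le> (2 ^ k) powr (- q)"
      using q by (intro powr_mono2') auto
    then have "(1 + \<bar>t\<bar>) powr (- q) \<le> c k"
      by (subst (asm) powr_mult) (auto simp: c_def powr_minus field_simps)
    moreover have "t \<in> J k" using k by (auto simp: J_def)
    ultimately show ?thesis by (intro exI[of _ k]) simp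
  qed
  have "(\<integral>\<^sup>+t. ennreal (\<sigma> t * (1 + \<bar>t\<bar>) powr (- q)) \<partial>lborel)
      \<le> (\<integral>\<^sup>+t. (\<Sum>k. ennreal (c k * (indicator (J k) t * \<sigma> t))) \<partial>lborel)"
  proof (rule nn_integral_mono)
    fix t :: real
    obtain k where k: "(1 + \<bar>t\<bar>) powr (- q) \<le> c k * indicator (J k) t" using dyadic by blast
    have "ennreal (\<sigma> t * (1 + \<bar>t\<bar>) powr (- q)) \<le> ennreal (c k * (indicator (J k) t * \<sigma> t))"
      using mult_left_mono[OF k \<sigma>_nonneg] by (intro ennreal_leI) (simp add: ac_simps)
    also have "\<dots> \<le> (\<Sum>k. ennreal (c k * (indicator (J k) t * \<sigma> t)))"
      using sum_le_suminf[of "\<lambda>k. ennreal (c k * (indicator (J k) t * \<sigma> t))" "{k}"] by simp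
    finally show "ennreal (\<sigma> t * (1 + \<bar>t\<bar>) powr (- q)) \<le> \<dots>" .
  qed
  also have "\<dots> = (\<Sum>k. \<integral>\<^sup>+t. ennreal (c k * (indicator (J k) t * \<sigma> t)) \<partial>lborel)"
    by (rule nn_integral_suminf) (simp add: J_def)
  also have "\<dots> \<le> (\<Sum>k. ennreal (2 powr q * A * \<rho> ^ k))"
  proof (rule suminf_le)
    fix k :: nat
    have "- (2 ^ k) < (2 ^ k :: real)" by (auto intro: less_trans[of _ 0])
    from \<sigma>_integrable[OF this] have int: "integrable lborel (\<lambda>t. c k * (indicator (J k) t * \<sigma> t))"
      by (simp add: set_integrable_def J_def)
    have "(\<integral>\<^sup>+t. ennreal (c k * (indicator (J k) t * \<sigma> t)) \<partial>lborel)
        = ennreal (c k * S (- (2 ^ k)) (2 ^ k))"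
      by (subst nn_integral_eq_integral[OF int])
        (auto simp: c0 \<sigma>_nonneg S_def set_lebesgue_integral_def J_def)
    also have "\<dots> \<le> ennreal (c k * (A * (2 ^ k) powr q * \<rho> ^ k))"
      by (intro ennreal_leI mult_left_mono A c0)
    \<comment> \<open>The power of \<open>2 ^ k\<close> cancels exactly and a geometric series with
      ratio \<rho> < 1 remains.\<close>
    also have "c k * (A * (2 ^ k) powr q * \<rho> ^ k) = 2 powr q * A * \<rho> ^ k"
      by (simp add: c_def powr_minus)
    finally show "(\<integral>\<^sup>+t. ennreal (c k * (indicator (J k) t * \<sigma> t)) \<partial>lborel) \<le> ennreal (2 powr q * A * \<rho> ^ k)" .
  qed auto
  also have "\<dots> < \<infinity>"
    using \<rho>_bounds A(1) by (subst suminf_ennreal2) (auto intro!: summable_mult summable_geometric)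
  finally show ?thesis
    unfolding q_def[symmetric]
    by (intro integrableI_nonneg) (auto simp: \<sigma>_nonneg)
qed

text \<open>This is the duality pairing of \<open>g w^(1/p)\<close> with
  \<open>w^(-1/p) / (1 + |t|)\<close>: the p'-th power of the second factor is the tail integrand of
  \<sigma>. A pointwise Young inequality again does the work of Hoelder. Points with
  \<open>g t = 0\<close> are split off so that its arguments are strictly positive.\<close>

lemma Lpw_integrable:
  assumes "in_Lpw p w g" shows "integrable lborel (\<lambda>t. g t / (1 + \<bar>t\<bar>))"
proof (rule Bochner_Integration.integrable_bound)
  have [measurable]: "g \<in> borel_measurable borel" using assms by (simp add: in_Lpw_def)
  define q where "q = p / (p - 1)"
  define h where "h t = 1 / p * (\<bar>g t\<bar> powr p * w t) + (p - 1) / p * (\<sigma> t * (1 + \<bar>t\<bar>) powr (- q))" for t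
  show "integrable lborel h"
    unfolding h_def q_def using assms integrable_\<sigma>_tail
    by (intro Bochner_Integration.integrable_add integrable_mult_right) (auto simp: in_Lpw_def)
  show "(\<lambda>t. g t / (1 + \<bar>t\<bar>)) \<in> borel_measurable lborel" by simp
  show "AE t in lborel. norm (g t / (1 + \<bar>t\<bar>)) \<le> norm (h t)"
    using w_pos
  proof eventually_elim
    fix t assume w: "0 < w t"
    have h0: "0 \<le> h t" unfolding h_def using p_gt_1 w by (intro add_nonneg_nonneg mult_nonneg_nonneg) (auto simp: \<sigma>_nonneg)
    show "norm (g t / (1 + \<bar>t\<bar>)) \<le> norm (h t)"
    proof (cases "g t = 0")
      case False
      have "(\<bar>g t\<bar> powr p * w t) powr (1 / p) * (\<sigma> t * (1 + \<bar>t\<bar>) powr (- q)) powr ((p - 1) / p) \<le> h t"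
        unfolding h_def using p_gt_1 w False by (intro Youngs_inequality_0) (auto simp: field_simps \<sigma>_def)
      also have "(\<bar>g t\<bar> powr p * w t) powr (1 / p) = \<bar>g t\<bar> * w t powr (1 / p)"
        using p_gt_1 w by (simp add: powr_mult powr_powr)
      also have "(\<sigma> t * (1 + \<bar>t\<bar>) powr (- q)) powr ((p - 1) / p) = w t powr (- (1 / p)) * (1 + \<bar>t\<bar>) powr (-1)"
        using p_gt_1 w by (simp add: powr_mult powr_powr \<sigma>_def \<sigma>_exponent q_def)
      also have "(1 + \<bar>t\<bar>) powr (-1) = 1 / (1 + \<bar>t\<bar>)" by (simp add: powr_minus_divide)
      finally have "\<bar>g t\<bar> * w t powr (1 / p) * (w t powr (- (1 / p)) * (1 / (1 + \<bar>t\<bar>))) \<le> h t" .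
      moreover have "w t powr (1 / p) * w t powr (- (1 / p)) = 1"
        using w by (simp flip: powr_add)
      ultimately show ?thesis using h0
        by (simp add: mult.assoc[symmetric]) (simp add: mult.assoc)
    qed (use h0 in simp)
  qed
qed

end

lemma Ap_weight_imp_muckenhoupt:
  assumes "1 < p" "Ap_weight p w" obtains K where "muckenhoupt p K w"
  using assms unfolding Ap_weight_def muckenhoupt_def by auto

section \<open>Harmonic functions and their holomorphic gradient\<close>

lemma frechet_derivative_px_py:
  assumes "v differentiable (at z)"
  shows "(v has_derivative (\<lambda>h. Re h * px v z + Im h * py v z)) (at z)"
proof -
  let ?D = "frechet_derivative v (at z)"
  have D: "(v has_derivative ?D) (at z)" using assms by (simp add: frechet_derivative_works)
  then interpret D: bounded_linear ?D by (rule has_derivative_bounded_linear)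
  have "?D h = Re h * px v z + Im h * py v z" for h
  proof -
    have "?D h = ?D (Re h *\<^sub>R 1 + Im h *\<^sub>R \<i>)"
      by (rule arg_cong[of _ _ ?D]) (simp add: complex_eq_iff)
    then show ?thesis by (simp only: D.add D.scaleR px_def py_def real_scaleR_def)
  qed
  then have "?D = (\<lambda>h. Re h * px v z + Im h * py v z)" by blast
  with D show ?thesis by simp
qed

lemma px_has_real_derivative:
  assumes "v differentiable (at (Complex s t))"
  shows "((\<lambda>s. v (Complex s t)) has_real_derivative px v (Complex s t)) (at s)"
proof -
  have "((\<lambda>s. Complex s t) has_derivative (\<lambda>h. of_real h)) (at s)"
    unfolding Complex_eq by (auto intro!: derivative_eq_intros)
  from has_derivative_compose[OF this frechet_derivative_px_py[OF assms]]
  show ?thesis by (simp add: has_field_derivative_def mult_commute_abs)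
qed

lemma py_has_real_derivative:
  assumes "v differentiable (at (Complex s t))"
  shows "((\<lambda>t. v (Complex s t)) has_real_derivative py v (Complex s t)) (at t)"
proof -
  have "((\<lambda>t. Complex s t) has_derivative (\<lambda>h. \<i> * of_real h)) (at t)"
    unfolding Complex_eq by (auto intro!: derivative_eq_intros)
  from has_derivative_compose[OF this frechet_derivative_px_py[OF assms]]
  show ?thesis by (simp add: has_field_derivative_def mult_commute_abs)
qed

text \<open>Two applications of the mean value theorem, first horizontally and then vertically. The
  second difference is symmetric in the two directions, whereas the order of application decides
  which mixed derivative appears; the companion lemma uses the other order.\<close>

lemma second_difference_py_px:
  assumes "0 < h"
    and sq: "\<And>s t. a \<le> s \<Longrightarrow> s \<le> a + h \<Longrightarrow> b \<le> t \<Longrightarrow> t \<le> b + h \<Longrightarrow>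
      u differentiable (at (Complex s t)) \<and> px u differentiable (at (Complex s t))"
  obtains s t where "a < s" "s < a + h" "b < t" "t < b + h"
    "u (Complex (a + h) (b + h)) - u (Complex (a + h) b) - u (Complex a (b + h)) + u (Complex a b)
      = h * h * py (px u) (Complex s t)"
proof -
  have "\<exists>s>a. s < a + h \<and>
     (u (Complex (a + h) (b + h)) - u (Complex (a + h) b)) - (u (Complex a (b + h)) - u (Complex a b))
     = (a + h - a) * (px u (Complex s (b + h)) - px u (Complex s b))"
    using assms by (intro MVT2[where f="\<lambda>s. u (Complex s (b + h)) - u (Complex s b)"])
      (auto intro!: DERIV_diff px_has_real_derivative)
  then obtain s where s: "a < s" "s < a + h"
    "u (Complex (a + h) (b + h)) - u (Complex (a + h) b) - u (Complex a (b + h)) + u (Complex a b)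
     = h * (px u (Complex s (b + h)) - px u (Complex s b))" by auto
  have "\<exists>t>b. t < b + h \<and> px u (Complex s (b + h)) - px u (Complex s b)
     = (b + h - b) * py (px u) (Complex s t)"
    using assms s by (intro MVT2[where f="\<lambda>t. px u (Complex s t)"])
      (auto intro!: py_has_real_derivative)
  with s that show ?thesis by auto
qed

lemma second_difference_px_py:
  assumes "0 < h"
    and sq: "\<And>s t. a \<le> s \<Longrightarrow> s \<le> a + h \<Longrightarrow> b \<le> t \<Longrightarrow> t \<le> b + h \<Longrightarrow>
      u differentiable (at (Complex s t)) \<and> py u differentiable (at (Complex s t))"
  obtains s t where "a < s" "s < a + h" "b < t" "t < b + h"
    "u (Complex (a + h) (b + h)) - u (Complex (a + h) b) - u (Complex a (b + h)) + u (Complex a b)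
      = h * h * px (py u) (Complex s t)"
proof -
  have "\<exists>t>b. t < b + h \<and>
     (u (Complex (a + h) (b + h)) - u (Complex a (b + h))) - (u (Complex (a + h) b) - u (Complex a b))
     = (b + h - b) * (py u (Complex (a + h) t) - py u (Complex a t))"
    using assms by (intro MVT2[where f="\<lambda>t. u (Complex (a + h) t) - u (Complex a t)"])
      (auto intro!: DERIV_diff py_has_real_derivative)
  then obtain t where t: "b < t" "t < b + h"
    "u (Complex (a + h) (b + h)) - u (Complex (a + h) b) - u (Complex a (b + h)) + u (Complex a b)
     = h * (py u (Complex (a + h) t) - py u (Complex a t))" by auto
  have "\<exists>s>a. s < a + h \<and> py u (Complex (a + h) t) - py u (Complex a t)
     = (a + h - a) * px (py u) (Complex s t)"
    using assms t by (intro MVT2[where f="\<lambda>s. py u (Complex s t)"])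
      (auto intro!: px_has_real_derivative)
  with t that show ?thesis by auto
qed

text \<open>Schwarz's theorem: on a small square one and the same second difference equals
  \<open>h * h\<close> times each mixed derivative at some point of the square. If the values at
  \<open>z\<close> differed, continuity would keep the two derivatives apart nearby.\<close>

lemma mixed_partials_commute:
  assumes "open S" "z \<in> S"
    and d: "\<And>z. z \<in> S \<Longrightarrow> u differentiable (at z)" "\<And>z. z \<in> S \<Longrightarrow> px u differentiable (at z)"
      "\<And>z. z \<in> S \<Longrightarrow> py u differentiable (at z)"
    and c: "continuous_on S (px (py u))" "continuous_on S (py (px u))"
  shows "px (py u) z = py (px u) z"
proof (rule ccontr)
  assume ne: "px (py u) z \<noteq> py (px u) z"
  define e where "e = dist (px (py u) z) (py (px u) z) / 2"
  have e: "0 < e" using ne by (simp add: e_def)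
  have "isCont (px (py u)) z" "isCont (py (px u)) z"
    using c assms(1,2) by (auto simp: continuous_on_eq_continuous_at)
  then obtain d1 d2 where d12: "0 < d1" "0 < d2"
      "\<And>z'. dist z' z < d1 \<Longrightarrow> dist (px (py u) z') (px (py u) z) < e"
      "\<And>z'. dist z' z < d2 \<Longrightarrow> dist (py (px u) z') (py (px u) z) < e"
    using e unfolding continuous_at_eps_delta by (metis dist_commute)
  obtain d3 where d3: "0 < d3" "ball z d3 \<subseteq> S" using assms(1,2) open_contains_ball by blast
  \<comment> \<open>Points of the square lie within \<open>2 * h\<close> of its corner
    \<open>z\<close>, so a third of the smallest radius is enough.\<close>
  define h where "h = min d1 (min d2 d3) / 3"
  have h: "0 < h" "2 * h < d1" "2 * h < d2" "2 * h < d3" using d12(1,2) d3(1) by (auto simp: h_def)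
  have near: "dist (Complex s t) z \<le> 2 * h"
    if "Re z \<le> s" "s \<le> Re z + h" "Im z \<le> t" "t \<le> Im z + h" for s t
    using cmod_le[of "Complex s t - z"] that by (simp add: dist_norm)
  have inS: "Complex s t \<in> S"
    if "Re z \<le> s" "s \<le> Re z + h" "Im z \<le> t" "t \<le> Im z + h" for s t
    using near[OF that] h(4) d3(2) by (auto simp: subset_iff dist_commute)
  obtain s t where st: "Re z < s" "s < Re z + h" "Im z < t" "t < Im z + h"
    "u (Complex (Re z + h) (Im z + h)) - u (Complex (Re z + h) (Im z)) - u (Complex (Re z) (Im z + h))
       + u (Complex (Re z) (Im z)) = h * h * py (px u) (Complex s t)"
    using second_difference_py_px[of h "Re z" "Im z" u] h(1) inS d by blast
  obtain s' t' where st': "Re z < s'" "s' < Re z + h" "Im z < t'" "t' < Im z + h"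
    "u (Complex (Re z + h) (Im z + h)) - u (Complex (Re z + h) (Im z)) - u (Complex (Re z) (Im z + h))
       + u (Complex (Re z) (Im z)) = h * h * px (py u) (Complex s' t')"
    using second_difference_px_py[of h "Re z" "Im z" u] h(1) inS d by blast
  have "py (px u) (Complex s t) = px (py u) (Complex s' t')"
    using st(5) st'(5) h(1) by simp
  moreover have "dist (py (px u) (Complex s t)) (py (px u) z) < e"
    using near[of s t] st h by (intro d12) auto
  moreover have "dist (px (py u) (Complex s' t')) (px (py u) z) < e"
    using near[of s' t'] st' h by (intro d12) auto
  ultimately show False
    using dist_triangle3[of "px (py u) z" "py (px u) z" "py (px u) (Complex s t)"]
    by (simp add: e_def)
qed

text \<open>For \<open>u_x - i u_y\<close> the Cauchy-Riemann equations are Laplace's equation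
  together with the symmetry of the mixed derivatives. The minus sign matters: \<open>grad u\<close>
  itself is the complex conjugate of this function.\<close>

lemma harmonic_gradient_holomorphic:
  assumes "harmonic_on S u"
  shows "(\<lambda>z. Complex (px u z) (- py u z)) holomorphic_on S"
proof -
  have S: "open S" using assms by (simp add: harmonic_on_def)
  have "\<exists>D. ((\<lambda>z. Complex (px u z) (- py u z)) has_field_derivative D) (at z)" if z: "z \<in> S" for z
  proof
    have comm: "px (py u) z = py (px u) z"
      using assms z S by (intro mixed_partials_commute[of S]) (auto simp: harmonic_on_def)
    have lap: "py (py u) z = - px (px u) z"
      using assms z unfolding harmonic_on_def by (metis add.commute add_eq_0_iff)
    have "px u differentiable (at z)" "py u differentiable (at z)"
      using assms z by (auto simp: harmonic_on_def)
    note * = this[THEN frechet_derivative_px_py]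
    have "((\<lambda>z. of_real (px u z) - \<i> * of_real (py u z)) has_derivative
       (\<lambda>h. of_real (Re h * px (px u) z + Im h * py (px u) z)
         - \<i> * of_real (Re h * px (py u) z + Im h * py (py u) z))) (at z)"
      by (intro has_derivative_diff has_derivative_mult_right has_derivative_of_real *)
    also have "(\<lambda>h. of_real (Re h * px (px u) z + Im h * py (px u) z)
         - \<i> * of_real (Re h * px (py u) z + Im h * py (py u) z))
       = (\<lambda>h. Complex (px (px u) z) (- px (py u) z) * h)"
      by (auto simp: fun_eq_iff complex_eq_iff comm lap algebra_simps)
    finally have "((\<lambda>z. of_real (px u z) - \<i> * of_real (py u z)) has_derivative
       (\<lambda>h. Complex (px (px u) z) (- px (py u) z) * h)) (at z)" .
    then show "((\<lambda>z. Complex (px u z) (- py u z)) has_field_derivative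
       Complex (px (px u) z) (- px (py u) z)) (at z)"
      by (simp add: has_field_derivative_def Complex_eq)
  qed
  then show ?thesis
    using S by (auto simp: holomorphic_on_open)
qed

section \<open>Cauchy integrals over the boundary of the half-plane\<close>

text \<open>In 1 + |t| \<le> 1 + |z| + |t - z| the constant part is absorbed using |t - z| \<ge> |Im
  z|. The result matches the weight 1/(1 + |t|) in which the boundary data are integrable;
  \<open>z\<close> may lie in either half-plane.\<close>

lemma cauchy_kernel_bound:
  assumes "Im z \<noteq> 0"
  shows "norm (1 / (of_real t - z)) \<le> (1 + (1 + norm z) / \<bar>Im z\<bar>) / (1 + \<bar>t\<bar>)"
proof -
  have y: "\<bar>Im z\<bar> \<le> norm (of_real t - z)"
    using abs_Im_le_cmod[of "of_real t - z"] by simp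
  have pos: "0 < norm (of_real t - z)" using y assms by linarith
  have "\<bar>t\<bar> \<le> norm (of_real t - z) + norm z"
    using norm_triangle_ineq[of "of_real t - z" z] by simp
  moreover have "1 + norm z \<le> (1 + norm z) / \<bar>Im z\<bar> * norm (of_real t - z)"
  proof -
    have "(1 + norm z) * \<bar>Im z\<bar> \<le> (1 + norm z) * norm (of_real t - z)"
      using y by (intro mult_left_mono) auto
    then show ?thesis using assms by (simp add: field_simps)
  qed
  ultimately have "1 + \<bar>t\<bar> \<le> (1 + (1 + norm z) / \<bar>Im z\<bar>) * norm (of_real t - z)"
    by (simp add: algebra_simps)
  then show ?thesis using pos by (simp add: norm_divide divide_simps add_pos_nonneg split: if_splits)
qed

lemma cauchy_kernel_integrable:
  fixes g :: "real \<Rightarrow> complex"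
  assumes "Im z \<noteq> 0" and g: "integrable lborel (\<lambda>t. g t / of_real (1 + \<bar>t\<bar>))"
  shows "integrable lborel (\<lambda>t. g t * (1 / (of_real t - z)))"
proof -
  define C where "C = 1 + (1 + norm z) / \<bar>Im z\<bar>"
  have gm [measurable]: "g \<in> borel_measurable borel"
  proof -
    have "(\<lambda>t. g t / of_real (1 + \<bar>t\<bar>) * of_real (1 + \<bar>t\<bar>)) \<in> borel_measurable lborel"
      using borel_measurable_integrable[OF g] by measurable
    also have "(\<lambda>t. g t / of_real (1 + \<bar>t\<bar>) * of_real (1 + \<bar>t\<bar>)) = g"
    proof
      fix t show "g t / of_real (1 + \<bar>t\<bar>) * of_real (1 + \<bar>t\<bar>) = g t"
        by (metis abs_add_one_gt_zero less_irrefl nonzero_eq_divide_eq of_real_eq_0_iff)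
    qed
    finally show ?thesis by simp
  qed
  show ?thesis
  proof (rule Bochner_Integration.integrable_bound)
    show "integrable lborel (\<lambda>t. C * norm (g t / of_real (1 + \<bar>t\<bar>)))"
      using g by (intro integrable_mult_right integrable_norm)
    show "(\<lambda>t. g t * (1 / (of_real t - z))) \<in> borel_measurable lborel" by measurable
    have "norm (g t * (1 / (of_real t - z))) \<le> norm (C * norm (g t / of_real (1 + \<bar>t\<bar>)))" for t
    proof -
      have "norm (g t * (1 / (of_real t - z))) \<le> norm (g t) * (C / (1 + \<bar>t\<bar>))"
        unfolding norm_mult C_def by (intro mult_left_mono cauchy_kernel_bound assms) auto
      also have "\<dots> = C * norm (g t / of_real (1 + \<bar>t\<bar>))"
        using norm_of_real[of "1 + \<bar>t\<bar>", where 'a=complex] by (simp add: norm_divide del: of_real_add)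
      finally show ?thesis by simp
    qed
    then show "AE t in lborel. norm (g t * (1 / (of_real t - z))) \<le> norm (C * norm (g t / of_real (1 + \<bar>t\<bar>)))"
      by simp
  qed
qed

text \<open>Bridge between two integrals: the bottom side of a rectangle yields a gauge integral
  over a bounded interval, while the final formula uses the Lebesgue integral over the line.\<close>

lemma integral_symmetric_tendsto:
  fixes h :: "real \<Rightarrow> complex"
  assumes "integrable lborel h"
  shows "(\<lambda>n. integral {- real n .. real n} h) \<longlonglongrightarrow> (LINT t|lborel. h t)"
proof -
  have [measurable]: "h \<in> borel_measurable borel" using assms by auto
  have eq: "integral {- real n .. real n} h = (LINT t|lborel. indicator {- real n .. real n} t *\<^sub>R h t)" for n
  proof -
    have "set_integrable lborel {- real n .. real n} h"
      unfolding set_integrable_def using assms by (intro integrable_mult_indicator) auto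
    then show ?thesis
      using set_borel_integral_eq_integral(2) by (metis set_lebesgue_integral_def)
  qed
  show ?thesis unfolding eq
  proof (rule integral_dominated_convergence[where w="\<lambda>t. norm (h t)"])
    show "AE t in lborel. (\<lambda>n. indicator {- real n .. real n} t *\<^sub>R h t) \<longlonglongrightarrow> h t"
    proof (rule AE_I2)
      fix t :: real
      obtain m where m: "\<bar>t\<bar> \<le> real m" using real_arch_simple by blast
      have "\<forall>\<^sub>F n in sequentially. indicator {- real n .. real n} t *\<^sub>R h t = h t"
        using eventually_ge_at_top[of m] by eventually_elim (use m in \<open>auto simp: indicator_def\<close>)
      then show "(\<lambda>n. indicator {- real n .. real n} t *\<^sub>R h t) \<longlonglongrightarrow> h t"
        by (rule tendsto_eventually)
    qed
  qed (use assms in \<open>auto simp: indicator_def\<close>)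
qed

text \<open>The three sides off the real axis have total length \<open>4 * n\<close> and consist of
  points of norm at least \<open>n\<close>, so they contribute at most \<open>4 * (n * b n)\<close>,
  which vanishes. Only the bottom side survives.\<close>

lemma rectangle_contour_limit:
  fixes h :: "complex \<Rightarrow> complex"
  assumes int: "integrable lborel (\<lambda>t. h (of_real t))"
    and cont: "\<forall>\<^sub>F n in sequentially. (h has_contour_integral I) (rectpath (Complex (- real n) 0) (Complex (real n) (real n)))"
    and bnd: "\<forall>\<^sub>F n in sequentially. \<forall>\<zeta>. norm \<zeta> \<ge> real n \<and> \<bar>Re \<zeta>\<bar> \<le> real n \<and> 0 \<le> Im \<zeta> \<and> Im \<zeta> \<le> real n
       \<longrightarrow> norm (h \<zeta>) \<le> b n"
    and b0: "(\<lambda>n. real n * b n) \<longlonglongrightarrow> 0"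
  shows "(LINT t|lborel. h (of_real t)) = I"
proof (rule LIMSEQ_unique[OF integral_symmetric_tendsto[OF int]])
  have "\<forall>\<^sub>F n in sequentially. norm (integral {- real n .. real n} (\<lambda>t. h (of_real t)) - I) \<le> 4 * (real n * b n)"
    using cont bnd eventually_gt_at_top[of 0]
  proof eventually_elim
    fix n :: nat
    assume ci: "(h has_contour_integral I) (rectpath (Complex (- real n) 0) (Complex (real n) (real n)))"
      and bn: "\<forall>\<zeta>. norm \<zeta> \<ge> real n \<and> \<bar>Re \<zeta>\<bar> \<le> real n \<and> 0 \<le> Im \<zeta> \<and> Im \<zeta> \<le> real n
       \<longrightarrow> norm (h \<zeta>) \<le> b n"
      and n: "0 < n"
    define a1 where "a1 = Complex (- real n) 0"
    define a2 where "a2 = Complex (real n) 0"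
    define a3 where "a3 = Complex (real n) (real n)"
    define a4 where "a4 = Complex (- real n) (real n)"
    \<comment> \<open>The side estimates need a nonnegative bound; the corner \<open>a2\<close> has
      norm \<open>n\<close> and supplies it.\<close>
    have b: "0 \<le> b n"
    proof -
      have "norm (h a2) \<le> b n" using bn[rule_format, of a2] by (simp add: a2_def complex_norm)
      then show ?thesis using norm_ge_zero order_trans by blast
    qed
    have ci': "(h has_contour_integral I) (linepath a1 a2 +++ linepath a2 a3 +++ linepath a3 a4 +++ linepath a4 a1)"
      using ci by (simp add: rectpath_def a1_def a2_def a3_def a4_def Let_def)
    then have "h contour_integrable_on (linepath a1 a2 +++ linepath a2 a3 +++ linepath a3 a4 +++ linepath a4 a1)"
      by (auto simp: contour_integrable_on_def)
    then have integ: "h contour_integrable_on linepath a1 a2" "h contour_integrable_on linepath a2 a3"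
      "h contour_integrable_on linepath a3 a4" "h contour_integrable_on linepath a4 a1"
      by (auto simp: contour_integrable_join)
    have sum: "contour_integral (linepath a1 a2) h + (contour_integral (linepath a2 a3) h +
       (contour_integral (linepath a3 a4) h + contour_integral (linepath a4 a1) h)) = I"
      using contour_integral_unique[OF ci'] integ by simp
    have bottom: "contour_integral (linepath a1 a2) h = integral {- real n .. real n} (\<lambda>t. h (of_real t))"
      using n contour_integral_linepath_Reals_eq[of a1 a2 h]
      by (simp add: a1_def a2_def complex_is_Real_iff)
    have sides: "norm (h \<zeta>) \<le> b n"
      if "\<zeta> \<in> closed_segment a2 a3 \<union> closed_segment a3 a4 \<union> closed_segment a4 a1" for \<zeta>
    proof -
      have "(Re \<zeta> = real n \<and> 0 \<le> Im \<zeta> \<and> Im \<zeta> \<le> real n) \<or> (Re \<zeta> = - real n \<and> 0 \<le> Im \<zeta> \<and> Im \<zeta> \<le> real n) \<or>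
         (Im \<zeta> = real n \<and> \<bar>Re \<zeta>\<bar> \<le> real n)"
        using that n by (auto simp: a1_def a2_def a3_def a4_def closed_segment_same_Re closed_segment_same_Im
            closed_segment_eq_real_ivl abs_le_iff)
      then show ?thesis
        using abs_Re_le_cmod[of \<zeta>] abs_Im_le_cmod[of \<zeta>] bn by auto
    qed
    have len: "norm (a3 - a2) = real n" "norm (a4 - a3) = 2 * real n" "norm (a1 - a4) = real n"
      by (simp_all add: a1_def a2_def a3_def a4_def cmod_def real_sqrt_mult)
    have "norm (contour_integral (linepath a2 a3) h) \<le> b n * real n"
      "norm (contour_integral (linepath a3 a4) h) \<le> b n * (2 * real n)"
      "norm (contour_integral (linepath a4 a1) h) \<le> b n * real n"
      using b integ sides len
      by (metis (no_types, lifting) has_contour_integral_bound_linepath has_contour_integral_integral UnCI)+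
    then have "norm (contour_integral (linepath a2 a3) h + (contour_integral (linepath a3 a4) h
        + contour_integral (linepath a4 a1) h)) \<le> 4 * (real n * b n)"
      by (intro order_trans[OF norm_triangle_ineq] order_trans[OF add_left_mono[OF norm_triangle_ineq]])
        (simp add: mult.commute mult.left_commute)
    moreover have "integral {- real n .. real n} (\<lambda>t. h (of_real t)) - I
      = - (contour_integral (linepath a2 a3) h + (contour_integral (linepath a3 a4) h
        + contour_integral (linepath a4 a1) h))"
      using sum bottom by (simp add: algebra_simps)
    ultimately show "norm (integral {- real n .. real n} (\<lambda>t. h (of_real t)) - I) \<le> 4 * (real n * b n)"
      by (simp only: norm_minus_cancel)
  qed
  then have "(\<lambda>n. integral {- real n .. real n} (\<lambda>t. h (of_real t)) - I) \<longlonglongrightarrow> 0"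
    by (rule Lim_null_comparison) (use tendsto_mult_left[OF b0, of 4] in simp)
  then show "(\<lambda>n. integral {- real n .. real n} (\<lambda>t. h (of_real t))) \<longlonglongrightarrow> I"
    by (simp add: LIM_zero_iff)
qed

lemma cauchy_kernel_diff_bound:
  fixes \<zeta> z z0 :: complex
  assumes "norm \<zeta> \<ge> R" "0 < R" "2 * norm z \<le> R" "2 * norm z0 \<le> R"
  shows "norm (1 / (\<zeta> - z) - 1 / (\<zeta> - z0)) \<le> 4 * norm (z - z0) / R\<^sup>2"
proof -
  have a: "R / 2 \<le> norm (\<zeta> - z)" "R / 2 \<le> norm (\<zeta> - z0)"
    using norm_triangle_ineq2[of \<zeta> z] norm_triangle_ineq2[of \<zeta> z0] assms by linarith+
  then have ne: "\<zeta> - z \<noteq> 0" "\<zeta> - z0 \<noteq> 0" using assms(2) by auto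
  then have "1 / (\<zeta> - z) - 1 / (\<zeta> - z0) = (z - z0) / ((\<zeta> - z) * (\<zeta> - z0))"
    by (simp add: field_simps)
  then have "norm (1 / (\<zeta> - z) - 1 / (\<zeta> - z0)) = norm (z - z0) / (norm (\<zeta> - z) * norm (\<zeta> - z0))"
    by (simp add: norm_divide norm_mult)
  also have "\<dots> \<le> norm (z - z0) / ((R / 2) * (R / 2))"
    using a assms(2) ne by (intro divide_left_mono mult_mono mult_pos_pos) auto
  also have "\<dots> = 4 * norm (z - z0) / R\<^sup>2" by (simp add: power2_eq_square)
  finally show ?thesis .
qed

text \<open>Leaving the contour value \<open>I\<close> open serves two cases: points inside the
  rectangles and their reflections below the axis. The sides contribute a multiple of
  \<open>B n / n\<close>, the quantity assumed to vanish.\<close>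

lemma half_plane_kernel_integral:
  fixes F :: "complex \<Rightarrow> complex"
  assumes int: "integrable lborel (\<lambda>t. F (of_real t) / of_real (1 + \<bar>t\<bar>))"
    and growth: "\<And>n \<zeta>. \<bar>Re \<zeta>\<bar> \<le> real n \<Longrightarrow> 0 \<le> Im \<zeta> \<Longrightarrow> norm (F \<zeta>) \<le> B n"
    and B: "(\<lambda>n. B n / real n) \<longlonglongrightarrow> 0"
    and z: "Im z \<noteq> 0" "Im z0 \<noteq> 0"
    and cont: "\<And>n. real n > norm z \<Longrightarrow> real n > norm z0 \<Longrightarrow>
       ((\<lambda>\<zeta>. F \<zeta> * (1 / (\<zeta> - z) - 1 / (\<zeta> - z0))) has_contour_integral I)
         (rectpath (Complex (- real n) 0) (Complex (real n) (real n)))"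
  shows "(LINT t|lborel. F (of_real t) * (1 / (of_real t - z) - 1 / (of_real t - z0))) = I"
proof (rule rectangle_contour_limit)
  show "integrable lborel (\<lambda>t. F (of_real t) * (1 / (of_real t - z) - 1 / (of_real t - z0)))"
    unfolding right_diff_distrib
    by (intro Bochner_Integration.integrable_diff cauchy_kernel_integrable int z)
  \<comment> \<open>From here on \<open>n\<close> is at least twice each norm, as the kernel
    estimate requires, and strictly larger than each norm, as the contour hypothesis
    requires.\<close>
  define m where "m = nat \<lceil>2 * norm z + 2 * norm z0 + 1\<rceil>"
  have m: "2 * norm z + 2 * norm z0 + 1 \<le> real n" if "m \<le> n" for n
    using that unfolding m_def by linarith
  show "\<forall>\<^sub>F n in sequentially. ((\<lambda>\<zeta>. F \<zeta> * (1 / (\<zeta> - z) - 1 / (\<zeta> - z0))) has_contour_integral I)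
         (rectpath (Complex (- real n) 0) (Complex (real n) (real n)))"
    using eventually_ge_at_top[of m]
  proof eventually_elim
    fix n assume "m \<le> n"
    from m[OF this] norm_ge_zero[of z] norm_ge_zero[of z0]
    have "norm z < real n" "norm z0 < real n" by linarith+
    then show "((\<lambda>\<zeta>. F \<zeta> * (1 / (\<zeta> - z) - 1 / (\<zeta> - z0))) has_contour_integral I)
         (rectpath (Complex (- real n) 0) (Complex (real n) (real n)))" by (rule cont)
  qed
  show "\<forall>\<^sub>F n in sequentially. \<forall>\<zeta>. norm \<zeta> \<ge> real n \<and> \<bar>Re \<zeta>\<bar> \<le> real n \<and> 0 \<le> Im \<zeta> \<and> Im \<zeta> \<le> real n
     \<longrightarrow> norm (F \<zeta> * (1 / (\<zeta> - z) - 1 / (\<zeta> - z0))) \<le> B n * (4 * norm (z - z0) / (real n)\<^sup>2)"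
    using eventually_ge_at_top[of m]
  proof eventually_elim
    fix n assume "m \<le> n"
    from m[OF this] norm_ge_zero[of z] norm_ge_zero[of z0]
    have n: "0 < real n" "2 * norm z \<le> real n" "2 * norm z0 \<le> real n" by linarith+
    show "\<forall>\<zeta>. norm \<zeta> \<ge> real n \<and> \<bar>Re \<zeta>\<bar> \<le> real n \<and> 0 \<le> Im \<zeta> \<and> Im \<zeta> \<le> real n
     \<longrightarrow> norm (F \<zeta> * (1 / (\<zeta> - z) - 1 / (\<zeta> - z0))) \<le> B n * (4 * norm (z - z0) / (real n)\<^sup>2)"
    proof (intro allI impI)
      fix \<zeta> assume *: "norm \<zeta> \<ge> real n \<and> \<bar>Re \<zeta>\<bar> \<le> real n \<and> 0 \<le> Im \<zeta> \<and> Im \<zeta> \<le> real n"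
      have F: "norm (F \<zeta>) \<le> B n" using * by (intro growth) auto
      have "0 \<le> B n" using order_trans[OF norm_ge_zero F] .
      then show "norm (F \<zeta> * (1 / (\<zeta> - z) - 1 / (\<zeta> - z0))) \<le> B n * (4 * norm (z - z0) / (real n)\<^sup>2)"
        unfolding norm_mult using n F * by (intro mult_mono cauchy_kernel_diff_bound) auto
    qed
  qed
  have "(\<lambda>n. 4 * norm (z - z0) * (B n / real n)) \<longlonglongrightarrow> 0"
    using tendsto_mult_left[OF B] by simp
  moreover have "\<forall>\<^sub>F n in sequentially. 4 * norm (z - z0) * (B n / real n)
      = real n * (B n * (4 * norm (z - z0) / (real n)\<^sup>2))"
    using eventually_gt_at_top[of 0] by eventually_elim (simp add: field_simps power2_eq_square)
  ultimately show "(\<lambda>n. real n * (B n * (4 * norm (z - z0) / (real n)\<^sup>2))) \<longlonglongrightarrow> 0"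
    by (rule Lim_transform_eventually)
qed

section \<open>Cauchy's formula and theorem on rectangles resting on the real axis\<close>

lemma half_plane_rectpath_image:
  assumes "0 < n"
  shows "path_image (rectpath (Complex (- real n) 0) (Complex (real n) (real n))) \<subseteq>
    {\<zeta>. 0 \<le> Im \<zeta> \<and> (\<bar>Re \<zeta>\<bar> = real n \<or> Im \<zeta> = real n \<or> Im \<zeta> = 0)}"
  by (subst path_image_rectpath) auto

text \<open>Holomorphy slightly below the axis lets the bottom side run along the real line. The
  bound on \<open>norm z\<close> puts \<open>z\<close> strictly inside the rectangle, where the
  winding number is 1.\<close>

lemma half_plane_cauchy_inside:
  fixes F :: "complex \<Rightarrow> complex"
  assumes F: "F holomorphic_on {\<zeta>. - e < Im \<zeta>}" "0 < e" and z: "0 < Im z" "norm z < real n"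
  shows "((\<lambda>\<zeta>. F \<zeta> / (\<zeta> - z)) has_contour_integral 2 * pi * \<i> * F z)
     (rectpath (Complex (- real n) 0) (Complex (real n) (real n)))"
proof -
  let ?r = "rectpath (Complex (- real n) 0) (Complex (real n) (real n))"
  have n: "0 < n" using z(2) norm_ge_zero[of z] by (cases n) (auto simp del: norm_ge_zero)
  have bnd: "\<bar>Re z\<bar> < real n" "Im z < real n"
    using abs_Re_le_cmod[of z] abs_Im_le_cmod[of z] z by linarith+
  have "((\<lambda>\<zeta>. F \<zeta> / (\<zeta> - z)) has_contour_integral 2 * pi * \<i> * winding_number ?r z * F z) ?r"
  proof (rule Cauchy_integral_formula_convex_simple[OF _ F(1)])
    show "convex {\<zeta>. - e < Im \<zeta>}" by (rule convex_halfspace_Im_gt)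
    show "z \<in> interior {\<zeta>. - e < Im \<zeta>}"
      using F(2) z by (subst interior_open) (auto intro: open_halfspace_Im_gt)
    show "path_image ?r \<subseteq> {\<zeta>. - e < Im \<zeta>} - {z}"
      using half_plane_rectpath_image[OF n] F(2) z(1) bnd by fastforce
  qed auto
  moreover have "winding_number ?r z = 1"
    using bnd z(1) by (intro winding_number_rectpath) (auto simp: in_box_complex_iff)
  ultimately show ?thesis by simp
qed

lemma half_plane_cauchy_outside:
  fixes F :: "complex \<Rightarrow> complex"
  assumes F: "F holomorphic_on {\<zeta>. - e < Im \<zeta>}" "0 < e" and z: "Im z < 0" and n: "0 < n"
  shows "((\<lambda>\<zeta>. F \<zeta> / (\<zeta> - z)) has_contour_integral 0)
     (rectpath (Complex (- real n) 0) (Complex (real n) (real n)))"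
proof (rule Cauchy_theorem_convex_simple)
  \<comment> \<open>A half-plane that still contains the rectangle but stops no lower than
    \<open>Im z\<close>, so the pole is left out.\<close>
  let ?S = "{\<zeta>. - min e (- Im z) < Im \<zeta>}"
  show "(\<lambda>\<zeta>. F \<zeta> / (\<zeta> - z)) holomorphic_on ?S"
    by (intro holomorphic_on_divide holomorphic_on_diff holomorphic_on_subset[OF F(1)]) auto
  show "convex ?S" by (rule convex_halfspace_Im_gt)
  show "path_image (rectpath (Complex (- real n) 0) (Complex (real n) (real n))) \<subseteq> ?S"
    using half_plane_rectpath_image[OF n] F(2) z by fastforce
qed auto

text \<open>Cauchy's formula at \<open>z\<close> and \<open>z0\<close>, minus the conjugate of Cauchy's theorem for the reflected
  points: only the imaginary part of \<open>F\<close> survives. Taking the difference of two kernels gives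
  quadratic decay, so growth \<open>o(R)\<close> of \<open>F\<close> suffices.\<close>

lemma half_plane_difference_representation:
  fixes F :: "complex \<Rightarrow> complex" and z z0 :: complex
  assumes F: "F holomorphic_on {\<zeta>. - e < Im \<zeta>}" "0 < e"
    and int: "integrable lborel (\<lambda>t. F (of_real t) / of_real (1 + \<bar>t\<bar>))"
    and growth: "\<And>n \<zeta>. \<bar>Re \<zeta>\<bar> \<le> real n \<Longrightarrow> 0 \<le> Im \<zeta> \<Longrightarrow> norm (F \<zeta>) \<le> B n"
    and B: "(\<lambda>n. B n / real n) \<longlonglongrightarrow> 0"
    and z: "0 < Im z" "0 < Im z0"
  shows "F z - F z0 = of_real (1 / pi) *
    (LINT t|lborel. of_real (Im (F (of_real t))) * (1 / (of_real t - z) - 1 / (of_real t - z0)))"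
proof -
  define k where "k t = 1 / (complex_of_real t - z) - 1 / (of_real t - z0)" for t
  have npos: "0 < n" if "norm z < real n" for n
    using that norm_ge_zero[of z] by (cases n) (auto simp del: norm_ge_zero)
  have in1: "(LINT t|lborel. F (of_real t) * k t) = 2 * pi * \<i> * F z - 2 * pi * \<i> * F z0"
    unfolding k_def
  proof (rule half_plane_kernel_integral[OF int growth B])
    fix n assume "norm z < real n" "norm z0 < real n"
    then have "((\<lambda>\<zeta>. F \<zeta> / (\<zeta> - z) - F \<zeta> / (\<zeta> - z0)) has_contour_integral 2 * pi * \<i> * F z - 2 * pi * \<i> * F z0)
       (rectpath (Complex (- real n) 0) (Complex (real n) (real n)))"
      by (intro has_contour_integral_diff half_plane_cauchy_inside[OF F] z)
    then show "((\<lambda>\<zeta>. F \<zeta> * (1 / (\<zeta> - z) - 1 / (\<zeta> - z0))) has_contour_integral 2 * pi * \<i> * F z - 2 * pi * \<i> * F z0)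
       (rectpath (Complex (- real n) 0) (Complex (real n) (real n)))"
      by (simp add: right_diff_distrib)
  qed (use z in auto)
  \<comment> \<open>As \<open>t\<close> is real, conjugating the kernel reflects its poles into the
    lower half-plane, outside every rectangle.\<close>
  have in2: "(LINT t|lborel. F (of_real t) * cnj (k t)) = 0"
  proof -
    have "cnj (k t) = 1 / (of_real t - cnj z) - 1 / (of_real t - cnj z0)" for t
      by (simp add: k_def)
    moreover have "(LINT t|lborel. F (of_real t) * (1 / (of_real t - cnj z) - 1 / (of_real t - cnj z0))) = 0"
    proof (rule half_plane_kernel_integral[OF int growth B])
      fix n assume "norm (cnj z) < real n" "norm (cnj z0) < real n"
      then have "((\<lambda>\<zeta>. F \<zeta> / (\<zeta> - cnj z) - F \<zeta> / (\<zeta> - cnj z0)) has_contour_integral 0 - 0)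
         (rectpath (Complex (- real n) 0) (Complex (real n) (real n)))"
        using z npos by (intro has_contour_integral_diff half_plane_cauchy_outside[OF F]) auto
      then show "((\<lambda>\<zeta>. F \<zeta> * (1 / (\<zeta> - cnj z) - 1 / (\<zeta> - cnj z0))) has_contour_integral 0)
         (rectpath (Complex (- real n) 0) (Complex (real n) (real n)))"
        by (simp add: right_diff_distrib)
    qed (use z in auto)
    ultimately show ?thesis by simp
  qed
  have i1: "integrable lborel (\<lambda>t. F (of_real t) * k t)"
    unfolding k_def right_diff_distrib using z
    by (intro Bochner_Integration.integrable_diff cauchy_kernel_integrable int) auto
  have "integrable lborel (\<lambda>t. F (of_real t) * (1 / (of_real t - cnj z)) - F (of_real t) * (1 / (of_real t - cnj z0)))"
    using z by (intro Bochner_Integration.integrable_diff cauchy_kernel_integrable int) auto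
  then have i2: "integrable lborel (\<lambda>t. cnj (F (of_real t) * cnj (k t)))"
    by (intro integrable_cnj) (simp add: k_def right_diff_distrib)
  have "(LINT t|lborel. cnj (F (of_real t)) * k t) = cnj (LINT t|lborel. F (of_real t) * cnj (k t))"
    by (subst Bochner_Integration.integral_cnj[symmetric]) simp
  then have in3: "(LINT t|lborel. cnj (F (of_real t)) * k t) = 0" by (simp add: in2)
  have "(LINT t|lborel. F (of_real t) * k t) - (LINT t|lborel. cnj (F (of_real t)) * k t)
      = (LINT t|lborel. F (of_real t) * k t - cnj (F (of_real t)) * k t)"
    using i1 i2 by (intro Bochner_Integration.integral_diff[symmetric]) auto
  also have "\<dots> = (LINT t|lborel. 2 * \<i> * (of_real (Im (F (of_real t))) * k t))"
    by (intro Bochner_Integration.integral_cong refl) (auto simp: complex_eq_iff algebra_simps)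
  also have "\<dots> = 2 * \<i> * (LINT t|lborel. of_real (Im (F (of_real t))) * k t)"
    by (rule integral_mult_right_zero)
  finally have "2 * pi * \<i> * F z - 2 * pi * \<i> * F z0 = 2 * \<i> * (LINT t|lborel. of_real (Im (F (of_real t))) * k t)"
    by (simp add: in1 in3)
  then have "2 * \<i> * (pi * (F z - F z0)) = 2 * \<i> * (LINT t|lborel. of_real (Im (F (of_real t))) * k t)"
    by (simp add: algebra_simps)
  then have "pi * (F z - F z0) = (LINT t|lborel. of_real (Im (F (of_real t))) * k t)"
    by simp
  then show ?thesis by (simp add: k_def field_simps)
qed

section \<open>The Cauchy transform of the boundary data\<close>

lemma measurable_of_weighted_integrable:
  fixes f :: "real \<Rightarrow> real"
  assumes "integrable lborel (\<lambda>t. f t / (1 + \<bar>t\<bar>))"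
  shows "f \<in> borel_measurable borel"
proof -
  have "(\<lambda>t. f t / (1 + \<bar>t\<bar>) * (1 + \<bar>t\<bar>)) \<in> borel_measurable lborel"
    using borel_measurable_integrable[OF assms] by measurable
  also have "(\<lambda>t. f t / (1 + \<bar>t\<bar>) * (1 + \<bar>t\<bar>)) = f" by (auto simp: fun_eq_iff add_nonneg_eq_0_iff)
  finally show ?thesis by simp
qed

text \<open>The kernel has the orientation 1/(z - t), the derivative of the logarithm of z - t, so
  that the transform is the complex gradient of \<open>u_f\<close>; relative to the kernel in
  Cauchy's formula the sign is reversed.\<close>

definition cauchy_transform :: "(real \<Rightarrow> real) \<Rightarrow> complex \<Rightarrow> complex" where
  "cauchy_transform f z = of_real (1 / pi) * (LINT t|lborel. of_real (f t) * (1 / (z - of_real t)))"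

lemma cauchy_transform_integrable:
  assumes "integrable lborel (\<lambda>t. f t / (1 + \<bar>t\<bar>))" "Im z \<noteq> 0"
  shows "integrable lborel (\<lambda>t. complex_of_real (f t) * (1 / (z - of_real t)))"
proof -
  have "integrable lborel (\<lambda>t. complex_of_real (f t / (1 + \<bar>t\<bar>)))"
    using assms(1) by (rule integrable_of_real)
  then have "integrable lborel (\<lambda>t. complex_of_real (f t) * (1 / (of_real t - z)))"
    by (intro cauchy_kernel_integrable assms) (simp add: of_real_divide)
  then have "integrable lborel (\<lambda>t. - (complex_of_real (f t) * (1 / (of_real t - z))))"
    by (rule Bochner_Integration.integrable_minus)
  also have "(\<lambda>t. - (complex_of_real (f t) * (1 / (of_real t - z)))) = (\<lambda>t. complex_of_real (f t) * (1 / (z - of_real t)))"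
    by (auto simp: fun_eq_iff) (metis minus_diff_eq divide_minus_right)
  finally show ?thesis .
qed

text \<open>Dominated convergence: the distance from \<open>\<i> * of_nat (Suc n)\<close> to
  \<open>t\<close> is at least \<open>Suc n\<close> and at least |t|. Starting at height 1 instead
  of 0 makes it at least (1 + |t|)/2, which gives the majorant.\<close>

lemma cauchy_transform_vertical_limit:
  assumes "integrable lborel (\<lambda>t. f t / (1 + \<bar>t\<bar>))"
  shows "(\<lambda>n. cauchy_transform f (\<i> * of_nat (Suc n))) \<longlonglongrightarrow> 0"
proof -
  note [measurable] = measurable_of_weighted_integrable[OF assms]
  have "(\<lambda>n. LINT t|lborel. of_real (f t) * (1 / (\<i> * of_nat (Suc n) - of_real t))) \<longlonglongrightarrow> (LINT t::real|lborel. (0::complex))"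
  proof (rule integral_dominated_convergence[where w="\<lambda>t. 2 * norm (f t / (1 + \<bar>t\<bar>))"])
    show "integrable lborel (\<lambda>t. 2 * norm (f t / (1 + \<bar>t\<bar>)))"
      using assms by (intro integrable_mult_right integrable_norm)
    have lower: "real (Suc n) \<le> norm (\<i> * of_nat (Suc n) - complex_of_real t)"
      "\<bar>t\<bar> \<le> norm (\<i> * of_nat (Suc n) - complex_of_real t)" for n t
      using abs_Im_le_cmod[of "\<i> * of_nat (Suc n) - complex_of_real t"]
        abs_Re_le_cmod[of "\<i> * of_nat (Suc n) - complex_of_real t"] by simp_all
    show "AE t in lborel. norm (of_real (f t) * (1 / (\<i> * of_nat (Suc n) - of_real t))) \<le> 2 * norm (f t / (1 + \<bar>t\<bar>))" for n
    proof (rule AE_I2)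
      fix t :: real
      define d where "d = norm (\<i> * of_nat (Suc n) - complex_of_real t)"
      have "1 + \<bar>t\<bar> \<le> 2 * d" "0 < d" using lower(1)[of n t] lower(2)[of t n] unfolding d_def by linarith+
      then have "1 / d \<le> 2 / (1 + \<bar>t\<bar>)" by (simp add: field_simps)
      then have "\<bar>f t\<bar> * (1 / d) \<le> \<bar>f t\<bar> * (2 / (1 + \<bar>t\<bar>))" by (rule mult_left_mono) simp
      then show "norm (of_real (f t) * (1 / (\<i> * of_nat (Suc n) - of_real t))) \<le> 2 * norm (f t / (1 + \<bar>t\<bar>))"
        unfolding norm_mult norm_divide d_def[symmetric] by (simp add: ac_simps)
    qed
    show "AE t in lborel. (\<lambda>n. of_real (f t) * (1 / (\<i> * of_nat (Suc n) - of_real t))) \<longlonglongrightarrow> (0::complex)"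
    proof (rule AE_I2)
      fix t :: real
      have "filterlim (\<lambda>n. norm (\<i> * of_nat (Suc n) - complex_of_real t)) at_top sequentially"
        by (rule filterlim_at_top_mono[OF _ always_eventually[OF allI, OF lower(1)]])
          (rule filterlim_compose[OF filterlim_real_sequentially filterlim_Suc])
      then have "(\<lambda>n. inverse (\<i> * of_nat (Suc n) - complex_of_real t)) \<longlonglongrightarrow> 0"
        by (intro filterlim_compose[OF tendsto_inverse_0]) (simp add: filterlim_at_infinity_conv_norm_at_top)
      from tendsto_mult_left[OF this]
      show "(\<lambda>n. of_real (f t) * (1 / (\<i> * of_nat (Suc n) - of_real t))) \<longlonglongrightarrow> (0::complex)"
        by (simp add: inverse_eq_divide)
    qed
  qed measurable
  from tendsto_mult_left[OF this, of "of_real (1 / pi)"] show ?thesis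
    unfolding cauchy_transform_def by (simp only: integral_zero mult_zero_right)
qed

section \<open>The gradient of the logarithmic potential\<close>

text \<open>The inequality ln x \<le> x - 1 is applied to the quotient and to its reciprocal, and |z
  - t| differs from 1 + |t| by at most 1 + |z|. So dividing by 1 + |t| inside the logarithm makes
  the kernel decay like 1/(1 + |t|), just enough for the integral to converge.\<close>

lemma log_kernel_bound:
  assumes "Im z \<noteq> 0"
  shows "\<bar>ln (norm (z - of_real t) / (1 + \<bar>t\<bar>))\<bar>
     \<le> (1 + norm z) * (1 + (1 + (1 + norm z) / \<bar>Im z\<bar>)) / (1 + \<bar>t\<bar>)"
proof -
  define d where "d = norm (z - of_real t)"
  define s where "s = 1 + \<bar>t\<bar>"
  define c where "c = 1 + (1 + norm z) / \<bar>Im z\<bar>"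
  have s: "0 < s" by (simp add: s_def)
  have d: "0 < d" using assms by (auto simp: d_def)
  have c: "0 \<le> c" by (simp add: c_def)
  have tri: "d \<le> norm z + \<bar>t\<bar>" "\<bar>t\<bar> \<le> d + norm z"
    using norm_triangle_ineq4[of z "of_real t"] norm_triangle_ineq3[of z "of_real t"] by (auto simp: d_def)
  have kern: "1 / d \<le> c / s"
    using cauchy_kernel_bound[OF assms, of t]
    by (simp add: d_def c_def s_def norm_divide norm_minus_commute)
  have "ln (d / s) \<le> d / s - 1" using s d by (intro ln_le_minus_one) simp
  also have "\<dots> = (d - s) / s" using s by (simp add: field_simps)
  also have "\<dots> \<le> (1 + norm z) / s" using tri s by (intro divide_right_mono) (auto simp: s_def)
  also have "\<dots> \<le> (1 + norm z) * (1 + c) / s" using s c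
    by (intro divide_right_mono) (auto simp: algebra_simps)
  finally have 1: "ln (d / s) \<le> (1 + norm z) * (1 + c) / s" .
  have "- ln (d / s) = ln (s / d)" using s d by (simp add: ln_div)
  also have "\<dots> \<le> s / d - 1" using s d by (intro ln_le_minus_one) simp
  also have "\<dots> = (s - d) * (1 / d)" using d by (simp add: field_simps)
  also have "\<dots> \<le> (1 + norm z) * (1 / d)" using tri d by (intro mult_right_mono) (auto simp: s_def)
  also have "\<dots> \<le> (1 + norm z) * (c / s)" by (intro mult_left_mono kern) auto
  also have "\<dots> \<le> (1 + norm z) * ((1 + c) / s)" using s c
    by (intro mult_left_mono divide_right_mono) auto
  finally have 2: "- ln (d / s) \<le> (1 + norm z) * (1 + c) / s" by simp
  from 1 2 show ?thesis unfolding d_def s_def c_def by linarith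
qed

lemma u_f_eq_norm:
  "u_f f z = 1 / pi * (LINT t|lborel. ln (norm (z - of_real t) / (1 + \<bar>t\<bar>)) * f t)"
  by (simp add: u_f_def cmod_def)

lemma u_f_integrable:
  assumes f: "integrable lborel (\<lambda>t. f t / (1 + \<bar>t\<bar>))" and "Im z \<noteq> 0"
  shows "integrable lborel (\<lambda>t. ln (norm (z - of_real t) / (1 + \<bar>t\<bar>)) * f t)"
proof (rule Bochner_Integration.integrable_bound)
  define C where "C = (1 + norm z) * (1 + (1 + (1 + norm z) / \<bar>Im z\<bar>))"
  note [measurable] = measurable_of_weighted_integrable[OF f]
  show "integrable lborel (\<lambda>t. C * norm (f t / (1 + \<bar>t\<bar>)))"
    using f by (intro integrable_mult_right integrable_norm)
  show "(\<lambda>t. ln (norm (z - of_real t) / (1 + \<bar>t\<bar>)) * f t) \<in> borel_measurable lborel" by measurable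
  show "AE t in lborel. norm (ln (norm (z - of_real t) / (1 + \<bar>t\<bar>)) * f t) \<le> norm (C * norm (f t / (1 + \<bar>t\<bar>)))"
  proof (rule AE_I2)
    fix t :: real
    have "norm (ln (norm (z - of_real t) / (1 + \<bar>t\<bar>)) * f t) \<le> C / (1 + \<bar>t\<bar>) * \<bar>f t\<bar>"
      unfolding real_norm_def abs_mult C_def by (intro mult_right_mono log_kernel_bound assms) auto
    also have "\<dots> = C * norm (f t / (1 + \<bar>t\<bar>))" by simp
    also have "\<dots> \<le> norm (C * norm (f t / (1 + \<bar>t\<bar>)))" unfolding real_norm_def by (rule abs_ge_self)
    finally show "norm (ln (norm (z - of_real t) / (1 + \<bar>t\<bar>)) * f t) \<le> norm (C * norm (f t / (1 + \<bar>t\<bar>)))" .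
  qed
qed

text \<open>With \<open>v = h / (z - t)\<close> the increment is the real part of
  \<open>Ln (1 + v)\<close>, whose linear part is \<open>v\<close>. Of the two factors 1/|z - t| in
  the quadratic remainder, one is bounded by 1/Im z and the other keeps the decay in
  \<open>t\<close>, so the remainder is integrable against \<open>f\<close>.\<close>

lemma log_kernel_taylor:
  assumes z: "0 < Im z" and h: "norm h \<le> Im z / 2"
  shows "\<bar>ln (norm (z + h - of_real t) / (1 + \<bar>t\<bar>)) - ln (norm (z - of_real t) / (1 + \<bar>t\<bar>))
      - Re (h * (1 / (z - of_real t)))\<bar>
    \<le> (norm h)\<^sup>2 * (2 / Im z * (1 + (1 + norm z) / \<bar>Im z\<bar>) / (1 + \<bar>t\<bar>))"
proof -
  define d where "d = z - complex_of_real t"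
  define v where "v = h / d"
  have d: "Im z \<le> norm d" using abs_Im_le_cmod[of d] z by (simp add: d_def)
  then have d0: "0 < norm d" "d \<noteq> 0" using z by auto
  have v: "norm v \<le> 1 / 2"
    using h d d0 by (simp add: v_def norm_divide field_simps)
  have v1: "1 + v \<noteq> 0"
  proof
    assume "1 + v = 0"
    then have "v = -1" by (simp add: add_eq_0_iff)
    with v show False by simp
  qed
  have split: "z + h - of_real t = d * (1 + v)" using d0 by (simp add: d_def v_def field_simps)
  have "ln (norm (z + h - of_real t) / (1 + \<bar>t\<bar>)) - ln (norm d / (1 + \<bar>t\<bar>)) = ln (norm (1 + v))"
    unfolding split norm_mult using d0 v1 by (simp add: ln_div ln_mult)
  also have "\<dots> = Re (Ln (1 + v))" using v1 by simp
  finally have "\<bar>ln (norm (z + h - of_real t) / (1 + \<bar>t\<bar>)) - ln (norm d / (1 + \<bar>t\<bar>)) - Re (h * (1 / d))\<bar>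
      = \<bar>Re (Ln (1 + v) - v)\<bar>" by (simp add: v_def)
  also have "\<dots> \<le> norm (Ln (1 + v) - v)" by (rule abs_Re_le_cmod)
  also have "\<dots> \<le> (norm v)\<^sup>2 / (1 - norm v)" using v by (intro Ln_approx_linear) simp
  also have "\<dots> \<le> (norm v)\<^sup>2 / (1 / 2)" using v by (intro divide_left_mono) auto
  also have "\<dots> = (norm h)\<^sup>2 * (2 / norm d * (1 / norm d))"
    by (simp add: v_def norm_divide power_divide power2_eq_square)
  also have "\<dots> \<le> (norm h)\<^sup>2 * (2 / Im z * ((1 + (1 + norm z) / \<bar>Im z\<bar>) / (1 + \<bar>t\<bar>)))"
  proof (intro mult_left_mono mult_mono)
    show "2 / norm d \<le> 2 / Im z" using d z by (intro divide_left_mono mult_pos_pos) auto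
    show "1 / norm d \<le> (1 + (1 + norm z) / \<bar>Im z\<bar>) / (1 + \<bar>t\<bar>)"
      using cauchy_kernel_bound[of z t] z by (simp add: d_def norm_divide norm_minus_commute)
  qed (use z in auto)
  finally show ?thesis by (simp add: d_def)
qed

text \<open>The pointwise remainder is quadratic in \<open>h\<close> with an integrable coefficient,
  so the expansion can be integrated directly. A derivative of the form \<open>Re (h * G)\<close>
  means that G is the x-derivative minus \<open>\<i>\<close> times the y-derivative.\<close>

lemma u_f_has_derivative:
  assumes f: "integrable lborel (\<lambda>t. f t / (1 + \<bar>t\<bar>))" and z: "0 < Im z"
  shows "(u_f f has_derivative (\<lambda>h. Re (h * cauchy_transform f z))) (at z)"
  unfolding has_derivative_at
proof
  show "bounded_linear (\<lambda>h. Re (h * cauchy_transform f z))"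
    by (intro bounded_linear_compose[OF bounded_linear_Re] bounded_linear_mult_left)
  define C where "C = 2 / Im z * (1 + (1 + norm z) / \<bar>Im z\<bar>)"
  define A where "A = 1 / pi * (LINT t|lborel. C * norm (f t / (1 + \<bar>t\<bar>)))"
  have Ci: "integrable lborel (\<lambda>t. C * norm (f t / (1 + \<bar>t\<bar>)))"
    using f by (intro integrable_mult_right integrable_norm)
  have main: "norm (u_f f (z + h) - u_f f z - Re (h * cauchy_transform f z)) \<le> (norm h)\<^sup>2 * A"
    if h: "norm h \<le> Im z / 2" for h
  proof -
    have zh: "Im (z + h) \<noteq> 0" using abs_Im_le_cmod[of h] h z by auto
    define e where "e t = ln (norm (z + h - of_real t) / (1 + \<bar>t\<bar>)) * f t
        - ln (norm (z - of_real t) / (1 + \<bar>t\<bar>)) * f t - Re (h * (of_real (f t) * (1 / (z - of_real t))))" for t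
    have i1: "integrable lborel (\<lambda>t. ln (norm (z + h - of_real t) / (1 + \<bar>t\<bar>)) * f t)"
      and i2: "integrable lborel (\<lambda>t. ln (norm (z - of_real t) / (1 + \<bar>t\<bar>)) * f t)"
      using z zh by (auto intro!: u_f_integrable f)
    have i3: "integrable lborel (\<lambda>t. h * (complex_of_real (f t) * (1 / (z - of_real t))))"
      using z by (intro integrable_mult_right cauchy_transform_integrable f) auto
    have ei: "integrable lborel e" unfolding e_def
      by (intro Bochner_Integration.integrable_diff i1 i2 integrable_Re i3)
    have "(LINT t|lborel. e t) = (LINT t|lborel. ln (norm (z + h - of_real t) / (1 + \<bar>t\<bar>)) * f t)
       - (LINT t|lborel. ln (norm (z - of_real t) / (1 + \<bar>t\<bar>)) * f t)
       - Re (h * (LINT t|lborel. of_real (f t) * (1 / (z - of_real t))))"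
      unfolding e_def integral_mult_right_zero[symmetric]
      by (subst Bochner_Integration.integral_diff, intro Bochner_Integration.integrable_diff i1 i2,
          intro integrable_Re i3, subst Bochner_Integration.integral_diff[OF i1 i2],
          subst integral_Re[OF i3]) (rule refl)
    then have "u_f f (z + h) - u_f f z - Re (h * cauchy_transform f z) = 1 / pi * (LINT t|lborel. e t)"
      unfolding u_f_eq_norm cauchy_transform_def
      by (simp only: mult.left_commute[of h] Re_complex_of_real Im_complex_of_real times_complex.sel right_diff_distrib mult_zero_left diff_zero)
    also have "norm \<dots> \<le> 1 / pi * (LINT t|lborel. (norm h)\<^sup>2 * (C * norm (f t / (1 + \<bar>t\<bar>))))"
      unfolding norm_mult
    proof (intro mult_mono)
      show "norm (LINT t|lborel. e t) \<le> (LINT t|lborel. (norm h)\<^sup>2 * (C * norm (f t / (1 + \<bar>t\<bar>))))"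
      proof (rule Bochner_Integration.integral_norm_bound_integral[OF ei])
        show "integrable lborel (\<lambda>t. (norm h)\<^sup>2 * (C * norm (f t / (1 + \<bar>t\<bar>))))"
          by (intro integrable_mult_right Ci)
        fix t :: real
        have "e t = (ln (norm (z + h - of_real t) / (1 + \<bar>t\<bar>)) - ln (norm (z - of_real t) / (1 + \<bar>t\<bar>))
            - Re (h * (1 / (z - of_real t)))) * f t"
          unfolding e_def mult.left_commute[of h] times_complex.sel(1)[of "of_real (f t)"]
          by (simp only: Re_complex_of_real Im_complex_of_real right_diff_distrib mult_zero_left diff_zero mult.commute[of _ "f t"])
        also have "norm \<dots> \<le> (norm h)\<^sup>2 * (C / (1 + \<bar>t\<bar>)) * \<bar>f t\<bar>"
          unfolding real_norm_def abs_mult C_def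
          using log_kernel_taylor[OF z h, of t] by (intro mult_right_mono) auto
        also have "\<dots> = (norm h)\<^sup>2 * (C * norm (f t / (1 + \<bar>t\<bar>)))" by simp
        finally show "norm (e t) \<le> (norm h)\<^sup>2 * (C * norm (f t / (1 + \<bar>t\<bar>)))" .
      qed
    qed auto
    also have "\<dots> = (norm h)\<^sup>2 * A"
      unfolding A_def by (subst integral_mult_right_zero) simp
    finally show ?thesis .
  qed
  show "((\<lambda>h. norm (u_f f (z + h) - u_f f z - Re (h * cauchy_transform f z)) / norm h) \<longlongrightarrow> 0) (at 0)"
  proof (rule Lim_null_comparison)
    have "\<forall>\<^sub>F h in at 0. norm h < Im z / 2 \<and> h \<noteq> (0::complex)"
      using z by (auto simp: eventually_at intro!: exI[of _ "Im z / 2"])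
    then show "\<forall>\<^sub>F h in at 0. norm (norm (u_f f (z + h) - u_f f z - Re (h * cauchy_transform f z)) / norm h) \<le> norm h * A"
    proof eventually_elim
      fix h :: complex assume "norm h < Im z / 2 \<and> h \<noteq> 0"
      then show "norm (norm (u_f f (z + h) - u_f f z - Re (h * cauchy_transform f z)) / norm h) \<le> norm h * A"
        using main[of h] by (simp add: divide_simps power2_eq_square ac_simps)
    qed
    show "((\<lambda>h::complex. norm h * A) \<longlongrightarrow> 0) (at 0)"
      by (auto intro!: tendsto_eq_intros)
  qed
qed

section \<open>Non-tangential maximal functions in weighted spaces\<close>

text \<open>Finiteness is essential: \<open>enn2real\<close> sends infinity to 0.\<close>

lemma norm_le_ntmax:
  fixes F :: "complex \<Rightarrow> 'a::real_normed_vector"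
  assumes "ntmax \<alpha> F x < \<infinity>" "\<zeta> \<in> cone \<alpha> x"
  shows "norm (F \<zeta>) \<le> enn2real (ntmax \<alpha> F x)"
proof -
  have "ennreal (norm (F \<zeta>)) \<le> ntmax \<alpha> F x"
    unfolding ntmax_def by (rule SUP_upper[OF assms(2)])
  from enn2real_mono[OF this] show ?thesis using assms(1) by simp
qed

context muckenhoupt
begin

text \<open>A Chebyshev argument: \<zeta> lies in the cone over every point of
  \<open>[c, d]\<close>, so the maximal function is at least \<open>norm (F \<zeta>)\<close> on that
  whole interval, wherever it is finite.\<close>

lemma ntmax_weight_bound:
  fixes F :: "complex \<Rightarrow> 'a::real_normed_vector"
  assumes N: "in_Lpw_enn p w (ntmax \<alpha> F)" and \<zeta>: "0 < Im \<zeta>"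
    and cd: "c < d" "\<And>x. c \<le> x \<Longrightarrow> x \<le> d \<Longrightarrow> \<bar>Re \<zeta> - x\<bar> < tan \<alpha> * Im \<zeta>"
  shows "norm (F \<zeta>) powr p * W c d \<le> (LINT x|lborel. \<bar>enn2real (ntmax \<alpha> F x)\<bar> powr p * w x)"
proof -
  have int: "integrable lborel (\<lambda>x. \<bar>enn2real (ntmax \<alpha> F x)\<bar> powr p * w x)"
    and fin: "AE x in lborel. ntmax \<alpha> F x < \<infinity>"
    using N by (auto simp: in_Lpw_enn_def in_Lpw_def)
  have "norm (F \<zeta>) powr p * W c d = (LINT x|lborel. norm (F \<zeta>) powr p * (indicator {c..d} x * w x))"
    by (simp add: W_def set_lebesgue_integral_def)
  also have "\<dots> \<le> (LINT x|lborel. \<bar>enn2real (ntmax \<alpha> F x)\<bar> powr p * w x)"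
  proof (rule integral_mono_AE[OF _ int])
    show "integrable lborel (\<lambda>x. norm (F \<zeta>) powr p * (indicator {c..d} x * w x))"
      using w_int[OF cd(1)] by (simp add: set_integrable_def)
    show "AE x in lborel. norm (F \<zeta>) powr p * (indicator {c..d} x * w x) \<le> \<bar>enn2real (ntmax \<alpha> F x)\<bar> powr p * w x"
      using fin
    proof eventually_elim
      fix x assume fin: "ntmax \<alpha> F x < \<infinity>"
      show "norm (F \<zeta>) powr p * (indicator {c..d} x * w x) \<le> \<bar>enn2real (ntmax \<alpha> F x)\<bar> powr p * w x"
      proof (cases "x \<in> {c..d}")
        case True
        then have "\<zeta> \<in> cone \<alpha> x" using \<zeta> cd by (simp add: cone_def)
        then have "norm (F \<zeta>) \<le> enn2real (ntmax \<alpha> F x)"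
          by (rule norm_le_ntmax[OF fin])
        then have "norm (F \<zeta>) powr p \<le> \<bar>enn2real (ntmax \<alpha> F x)\<bar> powr p"
          using p_gt_1 by (intro powr_mono2) auto
        then show ?thesis using True w_nonneg[of x] by (simp add: mult_right_mono)
      qed (simp add: w_nonneg)
    qed
  qed
  finally show ?thesis .
qed

lemma ntmax_vertical_decay:
  fixes F :: "complex \<Rightarrow> 'a::real_normed_vector"
  assumes N: "in_Lpw_enn p w (ntmax \<alpha> F)" and \<alpha>: "0 < tan \<alpha>"
  shows "(\<lambda>n. F (\<i> * of_nat (Suc n))) \<longlonglongrightarrow> 0"
proof -
  define M where "M = (LINT x|lborel. \<bar>enn2real (ntmax \<alpha> F x)\<bar> powr p * w x)"
  \<comment> \<open>Half the aperture, so that a closed interval fits into the open shadow of the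
    point.\<close>
  define \<tau> where "\<tau> = tan \<alpha> / 2"
  define V where "V n = W (- (\<tau> * real (Suc n))) (\<tau> * real (Suc n))" for n
  have \<tau>: "0 < \<tau>" "\<tau> < tan \<alpha>" using \<alpha> by (auto simp: \<tau>_def)
  have V: "0 < V n" for n unfolding V_def using \<tau> by (intro W_pos) (auto intro: less_trans[of _ 0])
  have bnd: "norm (F (\<i> * of_nat (Suc n))) \<le> (M / V n) powr (1 / p)" for n
  proof -
    have "norm (F (\<i> * of_nat (Suc n))) powr p * V n \<le> M"
      unfolding M_def V_def
    proof (rule ntmax_weight_bound[OF N])
      show "- (\<tau> * real (Suc n)) < \<tau> * real (Suc n)" using \<tau> by (auto intro: less_trans[of _ 0])
      fix x assume "- (\<tau> * real (Suc n)) \<le> x" "x \<le> \<tau> * real (Suc n)"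
      then have "\<bar>x\<bar> \<le> \<tau> * real (Suc n)" by auto
      also have "\<dots> < tan \<alpha> * real (Suc n)" using \<tau> by (intro mult_strict_right_mono) auto
      finally show "\<bar>Re (\<i> * of_nat (Suc n)) - x\<bar> < tan \<alpha> * Im (\<i> * of_nat (Suc n))" by simp
    qed simp
    then have "norm (F (\<i> * of_nat (Suc n))) powr p \<le> M / V n" using V[of n] by (simp add: field_simps)
    then have "(norm (F (\<i> * of_nat (Suc n))) powr p) powr (1 / p) \<le> (M / V n) powr (1 / p)"
      using p_gt_1 by (intro powr_mono2) auto
    then show ?thesis using p_gt_1 by (simp add: powr_powr)
  qed
  have "filterlim V at_top sequentially"
    unfolding V_def
    by (intro filterlim_compose[OF W_at_top] filterlim_tendsto_pos_mult_at_top[OF tendsto_const \<tau>(1)]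
        filterlim_compose[OF filterlim_real_sequentially filterlim_Suc])
  then have "(\<lambda>n. M / V n) \<longlonglongrightarrow> 0" by (rule tendsto_divide_0[OF tendsto_const filterlim_at_top_imp_at_infinity])
  moreover have "0 \<le> M" unfolding M_def by (intro Bochner_Integration.integral_nonneg) (simp add: w_nonneg)
  then have "\<forall>\<^sub>F n in sequentially. 0 \<le> M / V n" using V by (intro always_eventually allI divide_nonneg_pos)
  ultimately have "(\<lambda>n. (M / V n) powr (1 / p)) \<longlonglongrightarrow> 0 powr (1 / p)"
    using p_gt_1 by (intro tendsto_powr2) (auto simp: tendsto_const)
  then show ?thesis by (intro Lim_null_comparison[OF always_eventually[OF allI, OF bnd]]) simp
qed

text \<open>At height at least \<epsilon> the shadow of a point contains an interval of fixed radius
  \<tau>. \<open>W_compare\<close> bounds its mass below by a multiple of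
  \<open>V n / (n + 1)^p\<close>; taking p-th roots gives linear growth, and the divergence of
  \<open>V\<close> improves this to o(n).\<close>

lemma ntmax_horizontal_growth:
  fixes F :: "complex \<Rightarrow> 'a::real_normed_vector"
  assumes N: "in_Lpw_enn p w (ntmax \<alpha> F)" and \<alpha>: "0 < tan \<alpha>" and \<epsilon>: "0 < \<epsilon>" "\<epsilon> \<le> 1"
  obtains B where "\<And>n \<zeta>. \<bar>Re \<zeta>\<bar> \<le> real n \<Longrightarrow> \<epsilon> \<le> Im \<zeta> \<Longrightarrow> norm (F \<zeta>) \<le> B n"
    "(\<lambda>n. B n / real n) \<longlonglongrightarrow> 0"
proof
  define M where "M = (LINT x|lborel. \<bar>enn2real (ntmax \<alpha> F x)\<bar> powr p * w x)"
  \<comment> \<open>Small enough for the shadow at height \<epsilon>, and at most 1, so that the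
    interval around \<open>Re \<zeta>\<close> stays inside \<open>[-(n+1), n+1]\<close>; hence
    \<open>Suc n\<close> in \<open>V\<close>.\<close>
  define \<tau> where "\<tau> = min 1 (tan \<alpha> / 2) * \<epsilon>"
  define V where "V n = W (- real (Suc n)) (real (Suc n))" for n
  define B where "B n = real (Suc n) / \<tau> * (M * K / V n) powr (1 / p)" for n
  have \<tau>: "0 < \<tau>" "\<tau> \<le> 1" "\<tau> < tan \<alpha> * \<epsilon>"
    using \<alpha> \<epsilon> by (auto simp: \<tau>_def min_less_iff_disj mult_le_one intro!: mult_strict_right_mono)
  have V: "0 < V n" for n unfolding V_def by (intro W_pos) (auto intro: less_trans[of _ 0])
  have M: "0 \<le> M" unfolding M_def by (intro Bochner_Integration.integral_nonneg) (simp add: w_nonneg)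
  show "norm (F \<zeta>) \<le> B n" if \<zeta>: "\<bar>Re \<zeta>\<bar> \<le> real n" "\<epsilon> \<le> Im \<zeta>" for n \<zeta>
  proof -
    let ?c = "Re \<zeta> - \<tau>" and ?d = "Re \<zeta> + \<tau>"
    have 1: "norm (F \<zeta>) powr p * W ?c ?d \<le> M"
      unfolding M_def
    proof (rule ntmax_weight_bound[OF N])
      fix x assume "?c \<le> x" "x \<le> ?d"
      then have "\<bar>Re \<zeta> - x\<bar> \<le> \<tau>" by auto
      also have "\<dots> < tan \<alpha> * \<epsilon>" by (rule \<tau>)
      also have "\<dots> \<le> tan \<alpha> * Im \<zeta>" using \<zeta> \<alpha> by (intro mult_left_mono) auto
      finally show "\<bar>Re \<zeta> - x\<bar> < tan \<alpha> * Im \<zeta>" .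
    qed (use \<epsilon> \<zeta> \<tau> in auto)
    have "(?d - ?c) powr p * V n \<le> K * (real (Suc n) - - real (Suc n)) powr p * W ?c ?d"
      unfolding V_def using \<zeta> \<tau> by (intro W_compare) auto
    then have "(2 * \<tau>) powr p * V n \<le> K * (2 * real (Suc n)) powr p * W ?c ?d" by simp
    then have "\<tau> powr p * V n \<le> K * real (Suc n) powr p * W ?c ?d"
      unfolding powr_mult by simp
    then have "norm (F \<zeta>) powr p * (\<tau> powr p * V n) \<le> norm (F \<zeta>) powr p * (K * real (Suc n) powr p * W ?c ?d)"
      by (rule mult_left_mono) simp
    also have "\<dots> = (norm (F \<zeta>) powr p * W ?c ?d) * (K * real (Suc n) powr p)" by simp
    also have "\<dots> \<le> M * (K * real (Suc n) powr p)" using 1 K_pos by (intro mult_right_mono) auto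
    finally have "norm (F \<zeta>) powr p \<le> (M * K / V n) * (real (Suc n) powr p / \<tau> powr p)"
      using V[of n] \<tau> by (simp add: field_simps)
    then have "norm (F \<zeta>) powr p \<le> (M * K / V n) * (real (Suc n) / \<tau>) powr p"
      using \<tau> by (simp add: powr_divide)
    then have "(norm (F \<zeta>) powr p) powr (1 / p) \<le> ((M * K / V n) * (real (Suc n) / \<tau>) powr p) powr (1 / p)"
      using p_gt_1 by (intro powr_mono2) auto
    also have "\<dots> = (M * K / V n) powr (1 / p) * ((real (Suc n) / \<tau>) powr p) powr (1 / p)"
      by (rule powr_mult)
    finally show ?thesis using p_gt_1 \<tau> by (simp add: powr_powr B_def mult.commute)
  qed
  have "filterlim V at_top sequentially"
    unfolding V_def
    by (intro filterlim_compose[OF W_at_top] filterlim_compose[OF filterlim_real_sequentially filterlim_Suc])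
  then have "(\<lambda>n. M * K / V n) \<longlonglongrightarrow> 0" by (rule tendsto_divide_0[OF tendsto_const filterlim_at_top_imp_at_infinity])
  moreover have "\<forall>\<^sub>F n in sequentially. 0 \<le> M * K / V n"
    using V M K_pos by (intro always_eventually allI divide_nonneg_pos) auto
  ultimately have lim: "(\<lambda>n. (M * K / V n) powr (1 / p)) \<longlonglongrightarrow> 0 powr (1 / p)"
    using p_gt_1 by (intro tendsto_powr2) (auto simp: tendsto_const)
  have "(\<lambda>n. real (Suc n) / real n) \<longlonglongrightarrow> 1" by (rule LIMSEQ_Suc_n_over_n)
  from tendsto_mult[OF tendsto_mult_left[OF this, of "1 / \<tau>"] lim]
  show "(\<lambda>n. B n / real n) \<longlonglongrightarrow> 0"
    by (simp add: B_def mult_ac)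
qed

section \<open>Identification of the gradient with the Cauchy transform\<close>

lemma gradient_difference:
  assumes f: "in_Lpw p w f" and \<alpha>: "0 < tan \<alpha>"
    and u: "harmonic_on upper_half_plane u"
    and lim: "AE x in lborel. (py u \<longlongrightarrow> f x) (at (complex_of_real x) within cone \<alpha> x)"
    and N: "in_Lpw_enn p w (ntmax \<alpha> (grad u))"
    and z: "0 < Im z" "0 < Im z0"
  defines "F \<equiv> \<lambda>z. Complex (px u z) (- py u z)"
  shows "F z - F z0 = cauchy_transform f z - cauchy_transform f z0"
proof -
  \<comment> \<open>Shift heights tending to 0, positive and at most 1 as the growth lemma
    requires.\<close>
  define \<epsilon> where "\<epsilon> n = 1 / real (Suc n)" for n
  have \<epsilon>: "0 < \<epsilon> n" "\<epsilon> n \<le> 1" for n by (auto simp: \<epsilon>_def)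
  have \<epsilon>0: "\<epsilon> \<longlonglongrightarrow> 0" unfolding \<epsilon>_def by (rule LIMSEQ_Suc[OF lim_1_over_n])
  define N' where "N' x = enn2real (ntmax \<alpha> (grad u) x)" for x
  define k where "k t = 1 / (complex_of_real t - z) - 1 / (of_real t - z0)" for t
  have hol: "F holomorphic_on upper_half_plane"
    unfolding F_def by (rule harmonic_gradient_holomorphic[OF u])
  have Fgrad: "norm (F \<zeta>) = norm (grad u \<zeta>)" for \<zeta> by (simp add: F_def grad_def cmod_def)
  have fint: "integrable lborel (\<lambda>t. f t / (1 + \<bar>t\<bar>))" by (rule Lpw_integrable[OF f])
  have Nint: "integrable lborel (\<lambda>t. N' t / (1 + \<bar>t\<bar>))"
    using N unfolding N'_def by (intro Lpw_integrable) (simp add: in_Lpw_enn_def)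
  have Nfin: "AE x in lborel. ntmax \<alpha> (grad u) x < \<infinity>" using N by (simp add: in_Lpw_enn_def)
  have shift_hol: "(\<lambda>\<zeta>. F (\<zeta> + \<i> * of_real (\<epsilon> n))) holomorphic_on {\<zeta>. - \<epsilon> n < Im \<zeta>}" for n
  proof -
    have "(F \<circ> (\<lambda>\<zeta>. \<zeta> + \<i> * of_real (\<epsilon> n))) holomorphic_on {\<zeta>. - \<epsilon> n < Im \<zeta>}"
      by (rule holomorphic_on_compose_gen[OF _ hol])
        (auto simp: upper_half_plane_def intro!: holomorphic_intros)
    then show ?thesis by (simp add: o_def)
  qed
  have shift: "complex_of_real t + \<i> * of_real (\<epsilon> n) = Complex t (\<epsilon> n)" for t n
    by (simp add: Complex_eq)
  have Fm: "(\<lambda>t. F (of_real t + \<i> * of_real (\<epsilon> n))) \<in> borel_measurable borel" for n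
  proof (rule borel_measurable_continuous_onI)
    have "continuous_on UNIV (\<lambda>t. (\<lambda>\<zeta>. F (\<zeta> + \<i> * of_real (\<epsilon> n))) (complex_of_real t))"
      using \<epsilon>(1)[of n]
      by (intro continuous_on_compose2[OF holomorphic_on_imp_continuous_on[OF shift_hol[of n]]])
        (auto intro!: continuous_intros)
    then show "continuous_on UNIV (\<lambda>t. F (of_real t + \<i> * of_real (\<epsilon> n)))" by simp
  qed
  have FN: "AE t in lborel. norm (F (of_real t + \<i> * of_real (\<epsilon> n))) \<le> N' t" for n
    using Nfin
  proof eventually_elim
    fix t assume "ntmax \<alpha> (grad u) t < \<infinity>"
    then show "norm (F (of_real t + \<i> * of_real (\<epsilon> n))) \<le> N' t"
      unfolding Fgrad shift N'_def using \<alpha> \<epsilon> by (intro norm_le_ntmax) (auto simp: cone_def)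
  qed
  have rep: "F (z + \<i> * of_real (\<epsilon> n)) - F (z0 + \<i> * of_real (\<epsilon> n)) = of_real (1 / pi) *
    (LINT t|lborel. of_real (- py u (Complex t (\<epsilon> n))) * k t)" for n
  proof -
    obtain B where B: "\<And>m \<zeta>. \<bar>Re \<zeta>\<bar> \<le> real m \<Longrightarrow> \<epsilon> n \<le> Im \<zeta> \<Longrightarrow> norm (grad u \<zeta>) \<le> B m"
      "(\<lambda>m. B m / real m) \<longlonglongrightarrow> 0"
      using ntmax_horizontal_growth[OF N \<alpha> \<epsilon>] by blast
    have "F (z + \<i> * of_real (\<epsilon> n)) - F (z0 + \<i> * of_real (\<epsilon> n)) = of_real (1 / pi) *
      (LINT t|lborel. of_real (Im (F (of_real t + \<i> * of_real (\<epsilon> n)))) * (1 / (of_real t - z) - 1 / (of_real t - z0)))"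
    proof (rule half_plane_difference_representation[OF shift_hol \<epsilon>(1) _ _ B(2) z])
      show "integrable lborel (\<lambda>t. F (of_real t + \<i> * of_real (\<epsilon> n)) / of_real (1 + \<bar>t\<bar>))"
      proof (rule Bochner_Integration.integrable_bound[OF Nint])
        show "(\<lambda>t. F (of_real t + \<i> * of_real (\<epsilon> n)) / of_real (1 + \<bar>t\<bar>)) \<in> borel_measurable lborel"
          using Fm[of n] by measurable
        show "AE t in lborel. norm (F (of_real t + \<i> * of_real (\<epsilon> n)) / of_real (1 + \<bar>t\<bar>)) \<le> norm (N' t / (1 + \<bar>t\<bar>))"
          using FN[of n]
        proof eventually_elim
          fix t assume *: "norm (F (of_real t + \<i> * of_real (\<epsilon> n))) \<le> N' t"
          have "norm (complex_of_real (1 + \<bar>t\<bar>)) = 1 + \<bar>t\<bar>" unfolding norm_of_real by simp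
          then show "norm (F (of_real t + \<i> * of_real (\<epsilon> n)) / of_real (1 + \<bar>t\<bar>)) \<le> norm (N' t / (1 + \<bar>t\<bar>))"
            using * order_trans[OF norm_ge_zero *] unfolding norm_divide by (simp add: divide_right_mono)
        qed
      qed
      show "norm (F (\<zeta> + \<i> * of_real (\<epsilon> n))) \<le> B m" if "\<bar>Re \<zeta>\<bar> \<le> real m" "0 \<le> Im \<zeta>" for m \<zeta>
        unfolding Fgrad using that by (intro B) auto
    qed
    then show ?thesis by (simp only: shift k_def F_def complex.sel)
  qed
  have [measurable]: "f \<in> borel_measurable borel" using f by (simp add: in_Lpw_def)
  have [measurable]: "(\<lambda>t. py u (Complex t (\<epsilon> n))) \<in> borel_measurable borel" for n
  proof -
    have "(\<lambda>t. - Im (F (of_real t + \<i> * of_real (\<epsilon> n)))) \<in> borel_measurable borel"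
      using Fm[of n] by measurable
    then show ?thesis by (simp add: F_def Complex_eq)
  qed
  have [measurable]: "k \<in> borel_measurable borel" unfolding k_def by measurable
  define C where "C = (1 + (1 + norm z) / \<bar>Im z\<bar>) + (1 + (1 + norm z0) / \<bar>Im z0\<bar>)"
  have kb: "norm (k t) \<le> C / (1 + \<bar>t\<bar>)" for t
    unfolding k_def C_def add_divide_distrib[of _ _ "1 + \<bar>t\<bar>"] using z
    by (intro order_trans[OF norm_triangle_ineq4] add_mono cauchy_kernel_bound[unfolded add_divide_distrib[of _ _ "1 + \<bar>_\<bar>"]]) auto
  \<comment> \<open>The kernel decays like 1/(1 + |t|) and the maximal function dominates every
    shifted gradient, so their product is a majorant independent of \<open>n\<close>.\<close>
  have R: "(\<lambda>n. LINT t|lborel. of_real (- py u (Complex t (\<epsilon> n))) * k t) \<longlonglongrightarrow> (LINT t|lborel. of_real (- f t) * k t)"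
  proof (rule integral_dominated_convergence[where w="\<lambda>t. C * (N' t / (1 + \<bar>t\<bar>))"])
    show "integrable lborel (\<lambda>t. C * (N' t / (1 + \<bar>t\<bar>)))" by (intro integrable_mult_right Nint)
    show "AE t in lborel. norm (of_real (- py u (Complex t (\<epsilon> n))) * k t) \<le> C * (N' t / (1 + \<bar>t\<bar>))" for n
      using FN[of n]
    proof eventually_elim
      fix t assume *: "norm (F (of_real t + \<i> * of_real (\<epsilon> n))) \<le> N' t"
      have "\<bar>py u (Complex t (\<epsilon> n))\<bar> \<le> norm (F (of_real t + \<i> * of_real (\<epsilon> n)))"
        using abs_Im_le_cmod[of "F (Complex t (\<epsilon> n))"] unfolding shift by (simp add: F_def)
      then have "norm (of_real (- py u (Complex t (\<epsilon> n))) * k t) \<le> N' t * (C / (1 + \<bar>t\<bar>))"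
        unfolding norm_mult using * by (intro mult_mono kb) auto
      then show "norm (of_real (- py u (Complex t (\<epsilon> n))) * k t) \<le> C * (N' t / (1 + \<bar>t\<bar>))"
        by (simp add: mult.commute)
    qed
    show "AE t in lborel. (\<lambda>n. of_real (- py u (Complex t (\<epsilon> n))) * k t) \<longlonglongrightarrow> of_real (- f t) * k t"
      using lim
    proof eventually_elim
      fix t assume *: "(py u \<longlongrightarrow> f t) (at (complex_of_real t) within cone \<alpha> t)"
      \<comment> \<open>Vertical approach to \<open>t\<close> stays inside the cone over
        \<open>t\<close>, so the non-tangential limit applies along this sequence.\<close>
      have "filterlim (\<lambda>n. Complex t (\<epsilon> n)) (at (complex_of_real t) within cone \<alpha> t) sequentially"
        unfolding filterlim_at
      proof
        show "\<forall>\<^sub>F n in sequentially. Complex t (\<epsilon> n) \<in> cone \<alpha> t \<and> Complex t (\<epsilon> n) \<noteq> of_real t"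
          using \<epsilon> \<alpha> by (intro always_eventually) (auto simp: cone_def complex_eq_iff less_imp_neq[symmetric])
        have "(\<lambda>n. Complex t (\<epsilon> n)) \<longlonglongrightarrow> Complex t 0" by (intro tendsto_Complex tendsto_const \<epsilon>0)
        then show "(\<lambda>n. Complex t (\<epsilon> n)) \<longlonglongrightarrow> of_real t" by (simp add: Complex_eq)
      qed
      from filterlim_compose[OF * this]
      show "(\<lambda>n. of_real (- py u (Complex t (\<epsilon> n))) * k t) \<longlonglongrightarrow> of_real (- f t) * k t"
        by (intro tendsto_mult tendsto_const tendsto_of_real tendsto_minus)
    qed
  qed measurable
  have L: "(\<lambda>n. F (\<zeta> + \<i> * of_real (\<epsilon> n))) \<longlonglongrightarrow> F \<zeta>" if "0 < Im \<zeta>" for \<zeta>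
  proof -
    have "isCont F \<zeta>"
      using holomorphic_on_imp_continuous_on[OF hol] that open_halfspace_Im_gt[of 0]
      by (auto simp: upper_half_plane_def continuous_on_eq_continuous_at)
    moreover have "(\<lambda>n. \<zeta> + \<i> * of_real (\<epsilon> n)) \<longlonglongrightarrow> \<zeta>"
      using tendsto_add[OF tendsto_const tendsto_mult_left[OF tendsto_of_real[OF \<epsilon>0], of \<i>], of \<zeta>] by simp
    ultimately show ?thesis by (rule isCont_tendsto_compose)
  qed
  have "F z - F z0 = of_real (1 / pi) * (LINT t|lborel. of_real (- f t) * k t)"
    by (rule LIMSEQ_unique[OF tendsto_diff[OF L[OF z(1)] L[OF z(2)]]])
      (unfold rep, rule tendsto_mult_left[OF R])
  \<comment> \<open>Two signs cancel: \<open>Im F\<close> is minus the normal derivative, and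
    \<open>k\<close> uses t - z where the transform uses z - t.\<close>
  also have "(\<lambda>t. of_real (- f t) * k t) = (\<lambda>t. complex_of_real (f t) * (1 / (z - of_real t)) - of_real (f t) * (1 / (z0 - of_real t)))"
  proof
    fix t
    have "1 / (z - of_real t) = - (1 / (of_real t - z))" "1 / (z0 - of_real t) = - (1 / (of_real t - z0))"
      by (metis minus_diff_eq divide_minus_right)+
    then show "of_real (- f t) * k t = complex_of_real (f t) * (1 / (z - of_real t)) - of_real (f t) * (1 / (z0 - of_real t))"
      by (simp add: k_def algebra_simps)
  qed
  also have "(LINT t|lborel. complex_of_real (f t) * (1 / (z - of_real t)) - of_real (f t) * (1 / (z0 - of_real t)))
    = (LINT t|lborel. complex_of_real (f t) * (1 / (z - of_real t))) - (LINT t|lborel. of_real (f t) * (1 / (z0 - of_real t)))"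
    using z by (intro Bochner_Integration.integral_diff cauchy_transform_integrable fint) auto
  finally show ?thesis by (simp only: cauchy_transform_def right_diff_distrib)
qed

lemma gradient_eq_cauchy_transform:
  assumes f: "in_Lpw p w f" and \<alpha>: "0 < tan \<alpha>"
    and u: "harmonic_on upper_half_plane u"
    and lim: "AE x in lborel. (py u \<longlongrightarrow> f x) (at (complex_of_real x) within cone \<alpha> x)"
    and N: "in_Lpw_enn p w (ntmax \<alpha> (grad u))"
    and z: "0 < Im z"
  shows "Complex (px u z) (- py u z) = cauchy_transform f z"
proof -
  define F where "F z = Complex (px u z) (- py u z)" for z
  have "F (\<i> * of_nat (Suc n)) - cauchy_transform f (\<i> * of_nat (Suc n)) = F z - cauchy_transform f z" for n
    using gradient_difference[OF f \<alpha> u lim N, of "\<i> * of_nat (Suc n)" z] z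
    by (simp add: F_def algebra_simps)
  moreover have "(\<lambda>n. F (\<i> * of_nat (Suc n)) - cauchy_transform f (\<i> * of_nat (Suc n))) \<longlonglongrightarrow> 0 - 0"
  proof (rule tendsto_diff)
    \<comment> \<open>Decay is available for \<open>grad u\<close>, the conjugate of
      \<open>F\<close>; passing through norms transfers it.\<close>
    have "(\<lambda>n. norm (grad u (\<i> * of_nat (Suc n)))) \<longlonglongrightarrow> 0"
      by (rule tendsto_norm_zero[OF ntmax_vertical_decay[OF N \<alpha>]])
    moreover have "norm (grad u \<zeta>) = norm (F \<zeta>)" for \<zeta> by (simp add: F_def grad_def cmod_def)
    ultimately show "(\<lambda>n. F (\<i> * of_nat (Suc n))) \<longlonglongrightarrow> 0"
      by (simp only: tendsto_norm_zero_iff)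
    show "(\<lambda>n. cauchy_transform f (\<i> * of_nat (Suc n))) \<longlonglongrightarrow> 0"
      by (rule cauchy_transform_vertical_limit[OF Lpw_integrable[OF f]])
  qed
  ultimately have "(\<lambda>n::nat. F z - cauchy_transform f z) \<longlonglongrightarrow> 0" by simp
  then show ?thesis by (simp add: F_def LIMSEQ_const_iff)
qed

end

theorem theorem2p5:
  fixes p \<alpha> :: real and w f :: "real \<Rightarrow> real" and u :: "complex \<Rightarrow> real"
  assumes "1 < p"
    and "Ap_weight p w"
    and "in_Lpw p w f"
    and "0 < \<alpha>" and "\<alpha> < pi / 2"
    and "harmonic_on upper_half_plane u"
    and "AE x in lborel. (py u \<longlongrightarrow> f x) (at (complex_of_real x) within cone \<alpha> x)"
    and "in_Lpw_enn p w (ntmax \<alpha> (grad u))"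
  shows "\<exists>C::real. \<forall>z\<in>upper_half_plane. u z = u_f f z + C"
proof -
  obtain K where "muckenhoupt p K w" using Ap_weight_imp_muckenhoupt[OF assms(1,2)] .
  then interpret muckenhoupt p K w .
  have \<alpha>: "0 < tan \<alpha>" using assms(4,5) by (rule tan_gt_zero)
  have "\<exists>C. \<forall>z\<in>upper_half_plane. u z - u_f f z = C"
  proof (rule has_derivative_zero_constant)
    show "convex upper_half_plane" unfolding upper_half_plane_def by (rule convex_halfspace_Im_gt)
    fix z assume "z \<in> upper_half_plane"
    then have z: "0 < Im z" by (simp add: upper_half_plane_def)
    have "u differentiable (at z)"
      using assms(6) z by (simp add: harmonic_on_def upper_half_plane_def)
    note du = frechet_derivative_px_py[OF this]
    \<comment> \<open>\<open>Re (h * (u_x - i u_y))\<close> is the real linear form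
      \<open>Re h * u_x + Im h * u_y\<close>, so this derivative is the same as that of
      \<open>u\<close>.\<close>
    have duf: "(u_f f has_derivative (\<lambda>h. Re (h * Complex (px u z) (- py u z)))) (at z)"
      unfolding gradient_eq_cauchy_transform[OF assms(3) \<alpha> assms(6,7,8) z]
      by (rule u_f_has_derivative[OF Lpw_integrable[OF assms(3)] z])
    from has_derivative_diff[OF du duf]
    have "((\<lambda>z. u z - u_f f z) has_derivative (\<lambda>h. 0)) (at z)" by simp
    then show "((\<lambda>z. u z - u_f f z) has_derivative (\<lambda>h. 0)) (at z within upper_half_plane)"
      by (rule has_derivative_at_withinI)
  qed
  then obtain C where "\<forall>z\<in>upper_half_plane. u z - u_f f z = C" ..
  then show ?thesis by (intro exI[of _ C]) (auto simp: algebra_simps)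
qed

end
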